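(* Let $\mathcal F$ be an intersecting family in an ovoidal Möbius plane of odd order $q>3$. Then $|\mathcal F|\le q(q+1)$, with equality if and only if $\mathcal F$ consists of all circles through a fixed point.
   Context: An ovoid of $\mathrm{PG}(3,q)$, $q>2$, is a set $\mathcal Q$ of $q^2+1$ points, no three on a line (for $q$ odd, by Barlotti, it is an elliptic quadric $\mathcal Q^-(3,q)$). An oval is a set of $q+1$ points in a plane $\mathrm{PG}(2,q)$, no three on a line; a plane $\pi$ is an oval plane if $\pi\cap\mathcal Q$ is an oval in $\pi$. The ovoidal Möbius plane of order $q$ arising from $\mathcal Q$ has the points of $\mathcal Q$ as points and the sets $\pi\cap\mathcal Q$, $\pi$ an oval plane, as circles. An intersecting family is a set of circles any two of which have non-empty intersection. *)

theory Defs
  imports "HOL-Analysis.Cartesian_Space"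
begin

text \<open>
  The projective space PG(3,q) over a finite field of order q = CARD('a): points, lines and planes
  are the linear subspaces of dimension 1, 2 and 3 of the vector space \<open>'a ^ 4\<close>, and incidence
  is inclusion of subspaces.
\<close>

definition pg_points :: "('a::{field,finite} ^ 4) set set" where
  "pg_points = {P. vec.subspace P \<and> vec.dim P = 1}"

definition pg_lines :: "('a::{field,finite} ^ 4) set set" where
  "pg_lines = {L. vec.subspace L \<and> vec.dim L = 2}"

definition pg_planes :: "('a::{field,finite} ^ 4) set set" where
  "pg_planes = {\<pi>. vec.subspace \<pi> \<and> vec.dim \<pi> = 3}"

definition no_three_on_a_line :: "('a::{field,finite} ^ 4) set set \<Rightarrow> bool" where
  "no_three_on_a_line S \<longleftrightarrow>
     (\<forall>P\<in>S. \<forall>P'\<in>S. \<forall>P''\<in>S. P \<noteq> P' \<and> P \<noteq> P'' \<and> P' \<noteq> P'' \<longrightarrow>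
        \<not> (\<exists>L\<in>pg_lines. P \<subseteq> L \<and> P' \<subseteq> L \<and> P'' \<subseteq> L))"

text \<open>
  This is the usual notion of an ovoid for q > 2 only; the case q = 2 is not excluded here.
\<close>

definition ovoid :: "('a::{field,finite} ^ 4) set set \<Rightarrow> bool" where
  "ovoid Q \<longleftrightarrow> Q \<subseteq> pg_points \<and> card Q = CARD('a) ^ 2 + 1 \<and> no_three_on_a_line Q"

definition oval_in :: "('a::{field,finite} ^ 4) set \<Rightarrow> ('a ^ 4) set set \<Rightarrow> bool" where
  "oval_in \<pi> S \<longleftrightarrow> S \<subseteq> {P \<in> pg_points. P \<subseteq> \<pi>} \<and> card S = CARD('a) + 1 \<and> no_three_on_a_line S"

text \<open>
  The intersection of a plane with a set of points of PG(3,q).  As points are themselves sets of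
  vectors, this is not the set-theoretic intersection of \<open>\<pi>\<close> and \<open>Q\<close>.
\<close>

definition plane_section :: "('a::{field,finite} ^ 4) set \<Rightarrow> ('a ^ 4) set set \<Rightarrow> ('a ^ 4) set set" where
  "plane_section \<pi> Q = {P \<in> Q. P \<subseteq> \<pi>}"

definition oval_plane :: "('a::{field,finite} ^ 4) set set \<Rightarrow> ('a ^ 4) set \<Rightarrow> bool" where
  "oval_plane Q \<pi> \<longleftrightarrow> \<pi> \<in> pg_planes \<and> oval_in \<pi> (plane_section \<pi> Q)"

text \<open>
  The Moebius plane arising from an ovoid \<open>Q\<close> has the elements of \<open>Q\<close> as points and the following
  sets as circles.
\<close>

definition moebius_circles :: "('a::{field,finite} ^ 4) set set \<Rightarrow> ('a ^ 4) set set set" where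
  "moebius_circles Q = {plane_section \<pi> Q | \<pi>. oval_plane Q \<pi>}"

definition intersecting_family ::
    "('a::{field,finite} ^ 4) set set \<Rightarrow> ('a ^ 4) set set set \<Rightarrow> bool" where
  "intersecting_family Q F \<longleftrightarrow>
     F \<subseteq> moebius_circles Q \<and> (\<forall>C\<in>F. \<forall>D\<in>F. C \<inter> D \<noteq> {})"

end

theory Submission
  imports Defs
begin

text \<open>
  By Segre's lemma of tangents, the linear forms whose kernels are the tangent planes of the ovoid
  can be scaled so that they are symmetric on the ovoid; a linear map that agrees with them on a
  basis of points is then the polarity of a quadric containing the ovoid.  So a circle has a pole
  \<open>c\<close>, and the square class of the quadratic form at \<open>c\<close> splits the circles into classes such
  that tangent circles lie in the same class.

  Inside a class the tangency matrix \<open>T\<close> and the matrix \<open>G\<close> of intersection sizes satisfy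
  \<open>T\<^sup>2 = 2 (q + 1) J + (q\<^sup>2 - 1) I - 2 T - 2 G\<close>.  This yields the positive semidefinite matrix
  \<open>(q - 1) ((q - 1) I - T) - 2 (G - 2 J)\<close>, whose entries at intersecting pairs of circles are those of
  \<open>(q - 3) (G - 2 J)\<close>.  Hence, on average, two members of an intersecting family share at least two
  points, and a weighted Hoffman bound follows by projecting the indicator of the family onto the
  span of the stars.  In case of equality the indicator is a combination of stars, and integrality
  of the numbers of members through one and through two points leaves only a single star.
\<close>

section \<open>Counting in inversive planes\<close>

text \<open>A circle tangent to \<open>D\<close> lies in the class of \<open>D\<close>. So the
  pencil of \<open>C\<close> at a point off \<open>D\<close> contains no circle tangent to
  \<open>D\<close> when the classes differ, while it contains exactly two when they agree; this is
  why \<open>T\<close> can only be squared inside a class. Pairs from different classes need no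
  estimate, since they share exactly two points as soon as they intersect. The constant two is the
  average attained by a star: its centre has degree q (q + 1), every other point has degree q + 1,
  and the squares of these q^2 + 1 degrees sum to 2 (q (q + 1))^2. The semidefinite matrix has entry
  4 at disjoint pairs of a class, so only an intersecting family may replace it by
  \<open>(q - 3) (G - 2 J)\<close>; at q = 3 that factor vanishes and nothing would follow. Oddness
  of q enters through -1 differing from 1 in the field, which drives Segre's argument and keeps the
  two tangent circles of a pencil apart, and through parity at the very end, where weights 1/2 and 0
  together would make q even.\<close>

locale inversive_plane =
  fixes X :: "'p set" and \<C> :: "'p set set" and q :: nat
  assumes q_gt3: "q > 3" and finX: "finite X" and cardX: "card X = q^2 + 1"
    and circ_sub: "C \<in> \<C> \<Longrightarrow> C \<subseteq> X"
    and circ_card: "C \<in> \<C> \<Longrightarrow> card C = q + 1"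
    and three: "\<lbrakk>P \<in> X; R \<in> X; S \<in> X; P \<noteq> R; P \<noteq> S; R \<noteq> S\<rbrakk>
      \<Longrightarrow> \<exists>!C. C \<in> \<C> \<and> P \<in> C \<and> R \<in> C \<and> S \<in> C"
begin

lemma fin_circles: "finite \<C>"
  using circ_sub finX by (meson Pow_iff finite_Pow_iff finite_subset subsetI)

lemma fin_circ: "C \<in> \<C> \<Longrightarrow> finite C"
  using circ_sub finX finite_subset by blast

lemma circle_unique:
  assumes "C \<in> \<C>" "D \<in> \<C>" "P \<in> C \<inter> D" "R \<in> C \<inter> D" "S \<in> C \<inter> D" "P \<noteq> R" "P \<noteq> S" "R \<noteq> S"
  shows "C = D"
  using three[of P R S] assms circ_sub by blast

lemma inter_le_2:
  assumes "C \<in> \<C>" "D \<in> \<C>" "C \<noteq> D"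
  shows "card (C \<inter> D) \<le> 2"
proof (rule ccontr)
  assume "\<not> card (C \<inter> D) \<le> 2"
  hence "3 \<le> card (C \<inter> D)" by simp
  then obtain A where A: "A \<subseteq> C \<inter> D" "card A = 3"
    by (meson obtain_subset_with_card_n)
  then obtain P R S where "A = {P,R,S}" "P \<noteq> R" "R \<noteq> S" "P \<noteq> S"
    by (auto simp: card_3_iff)
  thus False using circle_unique[of C D P R S] A assms by auto
qed

lemma card_eq_1_iff: "R \<in> A \<Longrightarrow> card A = 1 \<longleftrightarrow> A = {R}"
  by (auto simp: card_1_singleton_iff)

text \<open>The circles through both points partition the other q^2 - 1 points, q - 1 to each
  circle.\<close>

lemma two_count:
  assumes "P \<in> X" "R \<in> X" "P \<noteq> R"
  shows "card {C \<in> \<C>. P \<in> C \<and> R \<in> C} = q + 1"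
proof -
  let ?S = "{C \<in> \<C>. P \<in> C \<and> R \<in> C}" and ?T = "X - {P,R}"
  have "(\<Sum>C\<in>?S. card {Z \<in> ?T. Z \<in> C}) = 1 * card ?T"
  proof (rule sum_multicount)
    show "\<forall>Z\<in>?T. card {C \<in> ?S. Z \<in> C} = 1"
    proof
      fix Z assume "Z \<in> ?T"
      then obtain C where "C \<in> \<C> \<and> P \<in> C \<and> R \<in> C \<and> Z \<in> C" 
         "\<And>D. D \<in> \<C> \<and> P \<in> D \<and> R \<in> D \<and> Z \<in> D \<Longrightarrow> D = C"
        using three[of P R Z] assms by blast
      hence "{C \<in> ?S. Z \<in> C} = {C}" by blast
      thus "card {C \<in> ?S. Z \<in> C} = 1" by simp
    qed
  qed (use fin_circles finX in auto)
  moreover have "card {Z \<in> ?T. Z \<in> C} = q - 1" if "C \<in> ?S" for C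
  proof -
    have "{Z \<in> ?T. Z \<in> C} = C - {P,R}" using that circ_sub by auto
    thus ?thesis using that assms circ_card fin_circ by (simp add: card_Diff_subset)
  qed
  moreover have "card ?T = q^2 - 1" using assms cardX finX by (simp add: card_Diff_subset)
  ultimately have "card ?S * (q - 1) = q^2 - 1" by simp
  also have "\<dots> = (q + 1) * (q - 1)"
    by (cases q) (simp_all add: power2_eq_square)
  finally show ?thesis using q_gt3 mult_cancel2[of _ "q - 1"] by (simp only: mult_cancel2) arith
qed

text \<open>The subfamily is arbitrary because the same count serves the whole plane and a single
  class, with different values of \<open>m\<close>.\<close>

lemma one_count_gen:
  assumes "P \<in> X" "\<K> \<subseteq> \<C>" and 2: "\<And>R. R \<in> X \<Longrightarrow> R \<noteq> P \<Longrightarrow> card {C \<in> \<K>. P \<in> C \<and> R \<in> C} = m"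
  shows "card {C \<in> \<K>. P \<in> C} = q * m"
proof -
  let ?S = "{C \<in> \<K>. P \<in> C}" and ?T = "X - {P}"
  have fin: "finite \<K>" using assms fin_circles finite_subset by blast
  have "(\<Sum>C\<in>?S. card {Z \<in> ?T. Z \<in> C}) = m * card ?T"
  proof (rule sum_multicount)
    show "\<forall>Z\<in>?T. card {C \<in> ?S. Z \<in> C} = m"
    proof
      fix Z assume "Z \<in> ?T"
      moreover have "{C \<in> ?S. Z \<in> C} = {C \<in> \<K>. P \<in> C \<and> Z \<in> C}" by blast
      ultimately show "card {C \<in> ?S. Z \<in> C} = m" using 2 by simp
    qed
  qed (use fin finX in auto)
  moreover have "card {Z \<in> ?T. Z \<in> C} = q" if "C \<in> ?S" for C
  proof -
    have "C \<in> \<C>" "P \<in> C" using that assms by auto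
    moreover from this have "{Z \<in> ?T. Z \<in> C} = C - {P}" using circ_sub by auto
    ultimately show ?thesis using circ_card fin_circ by (simp add: card_Diff_subset)
  qed
  moreover have "card ?T = q^2" using assms cardX finX by (simp add: card_Diff_subset)
  ultimately have "card ?S * q = m * q^2" by simp
  thus ?thesis using q_gt3 by (simp add: power2_eq_square)
qed

lemma one_count: "P \<in> X \<Longrightarrow> card {C \<in> \<C>. P \<in> C} = q * (q + 1)"
  by (rule one_count_gen) (use two_count in auto)

text \<open>Each of the q further points of \<open>C\<close> fixes one circle through
  \<open>P\<close> and \<open>R\<close>, and different points fix different circles because
  \<open>P\<close> is off \<open>C\<close>. This uses up q of the q + 1 circles through
  \<open>P\<close> and \<open>R\<close>; the one left over is tangent.\<close>

lemma touch:
  assumes "C \<in> \<C>" "R \<in> C" "P \<in> X" "P \<notin> C"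
  shows "card {E \<in> \<C>. P \<in> E \<and> E \<inter> C = {R}} = 1"
proof -
  have RX: "R \<in> X" "R \<noteq> P" using assms circ_sub by auto
  let ?A = "{E \<in> \<C>. P \<in> E \<and> R \<in> E}"
  let ?T = "{E \<in> \<C>. P \<in> E \<and> E \<inter> C = {R}}"
  define h where "h S = (THE E. E \<in> \<C> \<and> P \<in> E \<and> R \<in> E \<and> S \<in> E)" for S
  have h: "h S \<in> \<C> \<and> P \<in> h S \<and> R \<in> h S \<and> S \<in> h S" if "S \<in> C - {R}" for S
    unfolding h_def
  proof (rule theI'[OF three])
    show "S \<in> X" "P \<noteq> S" "R \<noteq> S" using that assms circ_sub by auto
  qed (use assms RX in auto)
  have hu: "h S = E" if "S \<in> C - {R}" "E \<in> \<C>" "P \<in> E" "R \<in> E" "S \<in> E" for S E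
    using circle_unique[of "h S" E P R S] h[OF that(1)] that assms RX by auto
  have inj: "inj_on h (C - {R})"
  proof (rule inj_onI)
    fix S S' assume *: "S \<in> C - {R}" "S' \<in> C - {R}" "h S = h S'"
    show "S = S'"
    proof (rule ccontr)
      assume "S \<noteq> S'"
      hence "h S = C" using circle_unique[of "h S" C R S S'] h[OF *(1)] h[OF *(2)] * assms by auto
      thus False using h[OF *(1)] assms by auto
    qed
  qed
  have eq: "?A = ?T \<union> h ` (C - {R})"
  proof -
    have "E \<in> h ` (C - {R})" if E: "E \<in> ?A" "E \<notin> ?T" for E
    proof -
      have "E \<inter> C \<noteq> {R}" "R \<in> E \<inter> C" using E assms by auto
      then obtain S where "S \<in> E \<inter> C" "S \<noteq> R" by blast
      thus ?thesis using hu[of S E] E by auto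
    qed
    thus ?thesis using h by blast
  qed
  have disj: "?T \<inter> h ` (C - {R}) = {}" using h by fastforce
  have "q + 1 = card ?T + card (h ` (C - {R}))"
    using two_count[of P R] assms RX eq disj fin_circles fin_circ[of C]
    by (simp add: card_Un_disjoint)
  also have "card (h ` (C - {R})) = q"
    using inj assms circ_card[of C] fin_circ[of C] by (simp add: card_image card_Diff_subset)
  finally show ?thesis by simp
qed

lemma touch_unique:
  assumes "C \<in> \<C>" "R \<in> C" "P \<in> X" "P \<notin> C"
    and "E \<in> \<C>" "P \<in> E" "E \<inter> C = {R}" "D \<in> \<C>" "P \<in> D" "D \<inter> C = {R}"
  shows "D = E"
proof -
  obtain Z where Z: "{E \<in> \<C>. P \<in> E \<and> E \<inter> C = {R}} = {Z}"
    using touch[OF assms(1-4)] by (rule card_1_singletonE)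
  have "E \<in> {Z}" "D \<in> {Z}" unfolding Z[symmetric] using assms by simp_all
  thus ?thesis by simp
qed

text \<open>A second common point of \<open>D\<close> and \<open>E\<close> would be off
  \<open>C\<close> and lie on two circles touching \<open>C\<close> at \<open>R\<close>.\<close>

lemma touch_trans:
  assumes "C \<in> \<C>" "R \<in> C" "E \<in> \<C>" "E \<inter> C = {R}" "D \<in> \<C>" "D \<inter> C = {R}"
  shows "D = E \<or> D \<inter> E = {R}"
proof (rule ccontr)
  assume *: "\<not> ?thesis"
  moreover have "R \<in> D \<inter> E" using assms by auto
  ultimately obtain P where P: "P \<in> D" "P \<in> E" "P \<noteq> R" by auto
  moreover have "P \<notin> C" using P assms(4) by auto
  moreover have "P \<in> X" using P assms(3) circ_sub by auto
  ultimately show False using touch_unique[of C R P E D] assms * by blast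
qed

text \<open>The circles touching \<open>C\<close> at \<open>R\<close> partition the q^2 - q points
  off \<open>C\<close>, q to each circle.\<close>

lemma touch_count:
  assumes "C \<in> \<C>" "R \<in> C"
  shows "card {E \<in> \<C>. E \<inter> C = {R}} = q - 1"
proof -
  let ?S = "{E \<in> \<C>. E \<inter> C = {R}}" and ?T = "X - C"
  have "(\<Sum>E\<in>?S. card {Z \<in> ?T. Z \<in> E}) = 1 * card ?T"
  proof (rule sum_multicount)
    show "\<forall>Z\<in>?T. card {E \<in> ?S. Z \<in> E} = 1"
    proof
      fix Z assume "Z \<in> ?T"
      hence "card {E \<in> \<C>. Z \<in> E \<and> E \<inter> C = {R}} = 1" using touch assms by auto
      moreover have "{E \<in> \<C>. Z \<in> E \<and> E \<inter> C = {R}} = {E \<in> ?S. Z \<in> E}" by auto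
      ultimately show "card {E \<in> ?S. Z \<in> E} = 1" by simp
    qed
  qed (use fin_circles finX in auto)
  moreover have "card {Z \<in> ?T. Z \<in> E} = q" if "E \<in> ?S" for E
  proof -
    have E: "E \<in> \<C>" "E \<inter> C = {R}" using that by auto
    have "R \<in> E \<inter> C" by (simp add: E(2))
    moreover have "Z \<in> C \<Longrightarrow> Z = R" if "Z \<in> E" for Z using that E(2) by (metis IntI singletonD)
    ultimately have "{Z \<in> ?T. Z \<in> E} = E - {R}" using circ_sub[OF E(1)] by blast
    thus ?thesis using \<open>R \<in> E \<inter> C\<close> circ_card[OF E(1)] fin_circ[OF E(1)] by (simp add: card_Diff_subset)
  qed
  moreover have "card ?T = q^2 - q"
    using assms cardX finX circ_card[of C] circ_sub[of C] fin_circ[of C] by (simp add: card_Diff_subset)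
  ultimately have "card ?S * q = q^2 - q" by simp
  also have "\<dots> = (q - 1) * q" by (simp add: power2_eq_square algebra_simps)
  finally show ?thesis using q_gt3 by simp
qed

lemma tangent_count_off:
  assumes "C \<in> \<C>" "P \<in> X" "P \<notin> C"
  shows "card {E \<in> \<C>. P \<in> E \<and> card (E \<inter> C) = 1} = q + 1"
proof -
  let ?S = "{E \<in> \<C>. P \<in> E \<and> card (E \<inter> C) = 1}"
  have "(\<Sum>R\<in>C. card {E \<in> ?S. E \<inter> C = {R}}) = 1 * card ?S"
  proof (rule sum_multicount)
    show "\<forall>E\<in>?S. card {R \<in> C. E \<inter> C = {R}} = 1"
    proof
      fix E assume "E \<in> ?S"
      then obtain R where "E \<inter> C = {R}" by (auto simp: card_1_singleton_iff)
      hence "{R \<in> C. E \<inter> C = {R}} = {R}" by auto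
      thus "card {R \<in> C. E \<inter> C = {R}} = 1" by simp
    qed
  qed (use fin_circles fin_circ assms in auto)
  moreover have "card {E \<in> ?S. E \<inter> C = {R}} = 1" if "R \<in> C" for R
  proof -
    have "{E \<in> ?S. E \<inter> C = {R}} = {E \<in> \<C>. P \<in> E \<and> E \<inter> C = {R}}" by auto
    thus ?thesis using touch assms that by simp
  qed
  ultimately show ?thesis using circ_card[of C] assms by simp
qed

end

text \<open>The two laws for \<open>cls\<close> are all that the counting sees of the quadric. In
  \<open>pencil_two\<close> the pencil of \<open>C\<close> at \<open>R\<close> includes
  \<open>C\<close> itself, so that the number two does not depend on whether \<open>C\<close>
  touches \<open>D\<close>.\<close>

locale moebius_plane = inversive_plane X \<C> q
  for X :: "'p set" and \<C> :: "'p set set" and q :: nat +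
  fixes cls :: "'p set \<Rightarrow> 'c"
  assumes odd_q: "odd q"
    and cls_tangent: "\<lbrakk>C \<in> \<C>; E \<in> \<C>; card (E \<inter> C) = 1\<rbrakk> \<Longrightarrow> cls E = cls C"
    and pencil_two: "\<lbrakk>C \<in> \<C>; D \<in> \<C>; cls C = cls D; R \<in> C; R \<notin> D\<rbrakk>
      \<Longrightarrow> card {E \<in> \<C>. (E = C \<or> E \<inter> C = {R}) \<and> card (E \<inter> D) = 1} = 2"
begin

section \<open>Circles of one class through one or two points\<close>

definition mates :: "'p set \<Rightarrow> 'p set set" where
  "mates C = {D \<in> \<C>. cls D = cls C}"

lemma mates_subset: "mates C \<subseteq> \<C>" and fin_mates: "finite (mates C)"
  using fin_circles unfolding mates_def by auto

lemma mates_tangent: "C \<in> \<C> \<Longrightarrow> D \<in> mates C \<Longrightarrow> E \<in> \<C> \<Longrightarrow> card (E \<inter> D) = 1 \<Longrightarrow> E \<in> mates C"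
  using cls_tangent[of D E] unfolding mates_def by auto

text \<open>Take a circle \<open>C\<close> of the class off \<open>P\<close> and count pairs of a
  circle \<open>E\<close> through \<open>P\<close> tangent to \<open>C\<close> and a circle
  \<open>D\<close> of the class through \<open>P\<close> and \<open>R\<close> in the pencil of
  \<open>E\<close> at \<open>P\<close>. Each of the q + 1 choices of \<open>E\<close> has one such
  \<open>D\<close>, and by \<open>pencil_two\<close> each \<open>D\<close> has two such
  \<open>E\<close>.\<close>

lemma class_two_count:
  assumes C0: "C0 \<in> \<C>" and "P \<in> X" "R \<in> X" "P \<noteq> R"
  shows "2 * card {C \<in> mates C0. P \<in> C \<and> R \<in> C} = q + 1"
proof -
  \<comment> \<open>If \<open>C0\<close> contains \<open>P\<close>, a circle touching
    \<open>C0\<close> at another point avoids \<open>P\<close> and is still in the class.\<close>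
  obtain C where C: "C \<in> mates C0" "P \<notin> C"
  proof (cases "P \<in> C0")
    case True
    have "card (C0 - {P}) = q" using circ_card C0 fin_circ True by (simp add: card_Diff_subset)
    then obtain S where S: "S \<in> C0" "S \<noteq> P" using q_gt3
      by (metis card.empty ex_in_conv insert_iff not_less0 DiffE)
    have "card {E \<in> \<C>. E \<inter> C0 = {S}} \<noteq> 0" using touch_count[OF C0 S(1)] q_gt3 by simp
    then obtain E where E: "E \<in> \<C>" "E \<inter> C0 = {S}" by (metis (mono_tags, lifting) Collect_empty_eq card.empty)
    hence "E \<in> mates C0" using mates_tangent[of C0 C0 E] C0 by (auto simp: mates_def)
    moreover have "P \<notin> E" using E S True by auto
    ultimately show ?thesis using that by blast
  next
    case False
    thus ?thesis using that[of C0] C0 by (auto simp: mates_def)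
  qed
  have CK: "C \<in> \<C>" "cls C = cls C0" using C by (auto simp: mates_def)
  let ?S = "{E \<in> \<C>. P \<in> E \<and> card (E \<inter> C) = 1}"
  let ?T = "{D \<in> mates C0. P \<in> D \<and> R \<in> D}"
  have SK: "E \<in> mates C0" if "E \<in> ?S" for E
    using mates_tangent[of C0 C E] C0 C(1) that by auto
  have "(\<Sum>E\<in>?S. card {D \<in> ?T. E = D \<or> E \<inter> D = {P}}) = 2 * card ?T"
  proof (rule sum_multicount)
    show "\<forall>D\<in>?T. card {E \<in> ?S. E = D \<or> E \<inter> D = {P}} = 2"
    proof
      fix D assume D: "D \<in> ?T"
      have "{E \<in> ?S. E = D \<or> E \<inter> D = {P}} = {E \<in> \<C>. (E = D \<or> E \<inter> D = {P}) \<and> card (E \<inter> C) = 1}"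
        using D by auto
      thus "card {E \<in> ?S. E = D \<or> E \<inter> D = {P}} = 2"
        using pencil_two[of D C P] D CK C by (auto simp: mates_def)
    qed
  qed (use fin_circles fin_mates in auto)
  moreover have "card {D \<in> ?T. E = D \<or> E \<inter> D = {P}} = 1" if E: "E \<in> ?S" for E
  proof (cases "R \<in> E")
    case True
    have "{D \<in> ?T. E = D \<or> E \<inter> D = {P}} = {E}"
    proof -
      have "D = E" if "D \<in> ?T" "E = D \<or> E \<inter> D = {P}" for D
      proof (rule ccontr)
        assume "D \<noteq> E"
        hence "R \<in> {P}" using that True by blast
        thus False using assms by simp
      qed
      thus ?thesis using True E SK[OF E] by blast
    qed
    thus ?thesis by simp
  next
    case False
    have "D \<in> ?T \<and> (E = D \<or> E \<inter> D = {P}) \<longleftrightarrow> D \<in> \<C> \<and> R \<in> D \<and> D \<inter> E = {P}" for D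
    proof
      assume *: "D \<in> \<C> \<and> R \<in> D \<and> D \<inter> E = {P}"
      hence "D \<in> mates C0" using mates_tangent[of C0 E D] C0 SK[OF E] E by simp
      moreover have "P \<in> D" using * by blast
      ultimately show "D \<in> ?T \<and> (E = D \<or> E \<inter> D = {P})" using * by (simp add: Int_commute)
    next
      assume *: "D \<in> ?T \<and> (E = D \<or> E \<inter> D = {P})"
      hence "E \<noteq> D" using False by blast
      thus "D \<in> \<C> \<and> R \<in> D \<and> D \<inter> E = {P}" using * mates_subset by (simp add: Int_commute mates_def)
    qed
    hence "{D \<in> ?T. E = D \<or> E \<inter> D = {P}} = {D \<in> \<C>. R \<in> D \<and> D \<inter> E = {P}}"
      by simp
    thus ?thesis using touch[of E P R] E False assms by simp
  qed
  ultimately show ?thesis using tangent_count_off[of C P] CK C assms by simp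
qed

lemma class_one_count:
  assumes C0: "C0 \<in> \<C>" and "P \<in> X"
  shows "2 * card {C \<in> mates C0. P \<in> C} = q * (q + 1)"
proof -
  have "card {C \<in> mates C0. P \<in> C} = q * ((q + 1) div 2)"
    using class_two_count[OF C0 assms(2)] by (intro one_count_gen assms mates_subset) fastforce
  moreover have "2 * ((q + 1) div 2) = q + 1" using odd_q by presburger
  ultimately show ?thesis by (metis mult.left_commute)
qed

section \<open>The matrices of intersection sizes and of tangencies on a class\<close>

definition meet :: "'p set \<Rightarrow> 'p set \<Rightarrow> real" where
  "meet C D = real (card (C \<inter> D))"

definition tang :: "'p set \<Rightarrow> 'p set \<Rightarrow> real" where
  "tang C D = of_bool (card (C \<inter> D) = 1)"

lemma meet_commute: "meet C D = meet D C" and tang_commute: "tang C D = tang D C"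
  by (simp_all add: meet_def tang_def Int_commute)

lemma Int_Collect_eq: "A \<inter> {x. Q x} = {x \<in> A. Q x}"
  by auto

lemma meet_sum: "C \<in> \<C> \<Longrightarrow> meet C E = (\<Sum>P\<in>C. of_bool (P \<in> E))"
  using fin_circ by (simp add: meet_def Int_def)

text \<open>Splitting tangency by the point of contact turns sums over \<open>tang\<close> into
  counts of circles touching at a given point.\<close>

lemma tang_sum:
  assumes "C \<in> \<C>"
  shows "tang C E = (\<Sum>R\<in>C. of_bool (E \<inter> C = {R}))"
proof (cases "card (C \<inter> E) = 1")
  case True
  then obtain R where R: "E \<inter> C = {R}" by (metis Int_commute card_1_singletonE)
  hence "R \<in> C" by blast
  hence "C \<inter> {S. E \<inter> C = {S}} = {R}" using R by auto
  thus ?thesis using True assms fin_circ by (simp add: tang_def)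
next
  case False
  hence "C \<inter> {S. E \<inter> C = {S}} = {}" by (auto simp: Int_commute)
  thus ?thesis using False assms fin_circ by (simp add: tang_def)
qed

lemma mates_circle: "D \<in> mates C \<Longrightarrow> D \<in> \<C>"
  using mates_subset by blast

lemma class_card:
  assumes "C0 \<in> \<C>"
  shows "2 * real (card (mates C0)) = real q * ((real q)^2 + 1)"
proof -
  have "(\<Sum>P\<in>X. card {C \<in> mates C0. P \<in> C}) = (q + 1) * card (mates C0)"
  proof (rule sum_multicount)
    show "\<forall>C\<in>mates C0. card {P \<in> X. P \<in> C} = q + 1"
    proof
      fix C assume "C \<in> mates C0"
      hence C: "C \<in> \<C>" by (rule mates_circle)
      hence "{P \<in> X. P \<in> C} = C" using circ_sub by auto
      thus "card {P \<in> X. P \<in> C} = q + 1" using circ_card C by simp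
    qed
  qed (use finX fin_mates in auto)
  hence "(q + 1) * (2 * card (mates C0)) = (\<Sum>P\<in>X. 2 * card {C \<in> mates C0. P \<in> C})"
    by (simp flip: sum_distrib_left)
  also have "\<dots> = (q + 1) * (q * (q^2 + 1))"
    using class_one_count[OF assms] cardX by (simp add: algebra_simps)
  finally have "2 * card (mates C0) = q * (q^2 + 1)" by (simp only: mult_cancel1) simp
  hence "real (2 * card (mates C0)) = real (q * (q^2 + 1))" by (rule arg_cong)
  thus ?thesis by (simp add: algebra_simps)
qed

lemma sum_meet_weighted:
  assumes "C \<in> \<C>"
  shows "(\<Sum>E\<in>mates C0. meet C E * w E) = (\<Sum>P\<in>C. \<Sum>E\<in>mates C0. of_bool (P \<in> E) * w E)"
  using assms by (simp add: meet_sum sum_distrib_right sum.swap[of _ C])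

lemma sum_tang_weighted:
  assumes "C \<in> \<C>"
  shows "(\<Sum>E\<in>mates C0. tang C E * w E) = (\<Sum>R\<in>C. \<Sum>E\<in>mates C0. of_bool (E \<inter> C = {R}) * w E)"
  using assms by (simp add: tang_sum sum_distrib_right sum.swap[of _ C])

lemma sum_meet:
  assumes "C0 \<in> \<C>" "C \<in> mates C0"
  shows "2 * (\<Sum>E\<in>mates C0. meet C E) = real q * (real q + 1)^2"
proof -
  have C: "C \<in> \<C>" using assms mates_circle by blast
  have *: "2 * (\<Sum>E\<in>mates C0. of_bool (P \<in> E)) = real q * (real q + 1)" if "P \<in> C" for P
  proof -
    have "real (2 * card {E \<in> mates C0. P \<in> E}) = real (q * (q + 1))"
      using class_one_count[OF assms(1), of P] that C circ_sub by (metis subsetD)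
    thus ?thesis using fin_mates by (simp add: Int_Collect_eq algebra_simps)
  qed
  have "2 * (\<Sum>E\<in>mates C0. meet C E) = (\<Sum>P\<in>C. 2 * (\<Sum>E\<in>mates C0. of_bool (P \<in> E)))"
    using sum_meet_weighted[of C "\<lambda>_. 1" C0] C by (simp add: sum_distrib_left)
  also have "\<dots> = real q * (real q + 1)^2"
    using * circ_card[OF C] by (simp add: power2_eq_square)
  finally show ?thesis .
qed

text \<open>With N the incidence matrix of the class, \<open>meet\<close> is N N^T, and 2 N^T N =
  (q^2 - 1) I + (q + 1) J because the class is a 2-design; multiply by N on the left and by N^T on
  the right.\<close>

lemma sum_meet_meet:
  assumes "C0 \<in> \<C>" "C \<in> mates C0" "D \<in> mates C0"
  shows "2 * (\<Sum>E\<in>mates C0. meet C E * meet E D) = ((real q)^2 - 1) * meet C D + (real q + 1)^3"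
proof -
  have C: "C \<in> \<C>" and D: "D \<in> \<C>" using assms mates_circle by blast+
  have *: "2 * (\<Sum>E\<in>mates C0. of_bool (P \<in> E) * of_bool (R \<in> E))
      = (real q + 1) + of_bool (P = R) * ((real q)^2 - 1)" if "P \<in> C" "R \<in> D" for P R
  proof (cases "P = R")
    case True
    have "real (2 * card {E \<in> mates C0. P \<in> E}) = real (q * (q + 1))"
      using class_one_count[OF assms(1), of P] that C circ_sub by (metis subsetD)
    thus ?thesis using fin_mates True
      by (simp add: Int_Collect_eq power2_eq_square algebra_simps flip: of_bool_conj)
  next
    case False
    have "real (2 * card {E \<in> mates C0. P \<in> E \<and> R \<in> E}) = real (q + 1)"
      using class_two_count[OF assms(1), of P R] that C D circ_sub False by (metis subsetD)
    thus ?thesis using fin_mates False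
      by (simp add: Int_Collect_eq flip: of_bool_conj)
  qed
  have "(\<Sum>E\<in>mates C0. of_bool (P \<in> E) * meet E D)
     = (\<Sum>R\<in>D. \<Sum>E\<in>mates C0. of_bool (P \<in> E) * of_bool (R \<in> E))" for P
    by (simp add: meet_commute[of _ D] meet_sum[OF D] sum_distrib_left sum.swap[of _ D])
  hence "2 * (\<Sum>E\<in>mates C0. meet C E * meet E D)
      = (\<Sum>P\<in>C. \<Sum>R\<in>D. 2 * (\<Sum>E\<in>mates C0. of_bool (P \<in> E) * of_bool (R \<in> E)))"
    by (simp add: sum_meet_weighted[OF C] sum_distrib_left)
  also have "\<dots> = (\<Sum>P\<in>C. \<Sum>R\<in>D. (real q + 1) + of_bool (P = R) * ((real q)^2 - 1))"
    by (intro sum.cong refl *)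
  also have "\<dots> = (\<Sum>P\<in>C. (real q + 1)^2 + of_bool (P \<in> D) * ((real q)^2 - 1))"
  proof (intro sum.cong refl)
    fix P
    have "(\<Sum>R\<in>D. of_bool (P = R) :: real) = of_bool (P \<in> D)"
      using fin_circ[OF D] by (simp add: of_bool_def)
    thus "(\<Sum>R\<in>D. (real q + 1) + of_bool (P = R) * ((real q)^2 - 1))
        = (real q + 1)^2 + of_bool (P \<in> D) * ((real q)^2 - 1)"
      using circ_card[OF D] by (simp add: sum.distrib power2_eq_square flip: sum_distrib_right)
  qed
  also have "\<dots> = (real q + 1)^3 + meet C D * ((real q)^2 - 1)"
    using circ_card[OF C] meet_sum[OF C, of D]
    by (simp add: sum.distrib power2_eq_square power3_eq_cube flip: sum_distrib_right)
  finally show ?thesis by simp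
qed

lemma class_touch_count:
  assumes "C0 \<in> \<C>" "C \<in> mates C0" "R \<in> C"
  shows "{E \<in> mates C0. E \<inter> C = {R}} = {E \<in> \<C>. E \<inter> C = {R}}"
    and "real (card {E \<in> mates C0. E \<inter> C = {R}}) = real q - 1"
proof -
  have C: "C \<in> \<C>" using assms mates_circle by blast
  show 1: "{E \<in> mates C0. E \<inter> C = {R}} = {E \<in> \<C>. E \<inter> C = {R}}"
    using mates_tangent[OF assms(1,2)] mates_circle by auto
  show "real (card {E \<in> mates C0. E \<inter> C = {R}}) = real q - 1"
    unfolding 1 using touch_count[OF C assms(3)] q_gt3 by simp
qed

lemma sum_tang:
  assumes "C0 \<in> \<C>" "C \<in> mates C0"
  shows "(\<Sum>E\<in>mates C0. tang C E) = (real q)^2 - 1"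
proof -
  have C: "C \<in> \<C>" using assms mates_circle by blast
  have "(\<Sum>E\<in>mates C0. tang C E) = (\<Sum>R\<in>C. real q - 1)"
    using sum_tang_weighted[of C "\<lambda>_. 1" C0] C class_touch_count(2)[OF assms] fin_mates
    by (simp add: Int_Collect_eq)
  thus ?thesis using circ_card[OF C] by (simp add: power2_eq_square algebra_simps)
qed

text \<open>Fix a point \<open>P\<close> of \<open>D\<close>. It lies on q + 1 circles of the class
  tangent to \<open>C\<close> if it is off \<open>C\<close>, and on q - 1 if it is on
  \<open>C\<close>; sum over the points of \<open>D\<close>.\<close>

lemma sum_tang_meet:
  assumes "C0 \<in> \<C>" "C \<in> mates C0" "D \<in> mates C0"
  shows "(\<Sum>E\<in>mates C0. tang C E * meet E D) = (real q + 1)^2 - 2 * meet C D"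
proof -
  have C: "C \<in> \<C>" and D: "D \<in> \<C>" using assms mates_circle by blast+
  have *: "(\<Sum>E\<in>mates C0. of_bool (P \<in> E) * tang C E) = (real q + 1) - 2 * of_bool (P \<in> C)"
    if P: "P \<in> D" for P
  proof -
    have 1: "(\<Sum>E\<in>mates C0. of_bool (P \<in> E) * tang C E) = real (card {E \<in> mates C0. P \<in> E \<and> card (C \<inter> E) = 1})"
      using fin_mates by (simp add: tang_def Int_Collect_eq flip: of_bool_conj)
    show ?thesis
    proof (cases "P \<in> C")
      case True
      have "P \<in> E \<and> card (C \<inter> E) = 1 \<longleftrightarrow> E \<inter> C = {P}" for E
      proof
        assume "P \<in> E \<and> card (C \<inter> E) = 1"
        thus "E \<inter> C = {P}" using card_eq_1_iff[of P "E \<inter> C"] True by (simp add: Int_commute)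
      next
        assume *: "E \<inter> C = {P}"
        hence "P \<in> E" by blast
        thus "P \<in> E \<and> card (C \<inter> E) = 1" using * by (simp add: Int_commute)
      qed
      thus ?thesis using 1 class_touch_count[OF assms(1,2) True] True by simp
    next
      case False
      have "P \<in> X" using P D circ_sub by blast
      moreover have "{E \<in> mates C0. P \<in> E \<and> card (C \<inter> E) = 1} = {E \<in> \<C>. P \<in> E \<and> card (E \<inter> C) = 1}"
        using mates_tangent[OF assms(1,2)] mates_circle by (auto simp: Int_commute)
      ultimately show ?thesis using 1 tangent_count_off[OF C _ False] False by simp
    qed
  qed
  have "(\<Sum>E\<in>mates C0. tang C E * meet E D) = (\<Sum>E\<in>mates C0. meet D E * tang C E)"
    by (simp add: mult.commute meet_commute)
  also have "\<dots> = (\<Sum>P\<in>D. (real q + 1) - 2 * of_bool (P \<in> C))"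
    using * by (simp add: sum_meet_weighted[OF D])
  also have "\<dots> = (real q + 1)^2 - 2 * meet C D"
    using circ_card[OF D] meet_sum[OF D, of C]
    by (simp add: sum_subtractf power2_eq_square meet_commute[of C] flip: sum_distrib_left)
  finally show ?thesis .
qed

text \<open>The common tangents are sorted by their contact point \<open>R\<close> with
  \<open>C\<close>. For \<open>R\<close> off \<open>D\<close> the count comes from
  \<open>pencil_two\<close>, less one if \<open>C\<close> itself touches \<open>D\<close>; for
  \<open>R\<close> on both circles it depends only on how they meet.\<close>

lemma sum_tang_tang:
  assumes "C0 \<in> \<C>" "C \<in> mates C0" "D \<in> mates C0"
  shows "(\<Sum>E\<in>mates C0. tang C E * tang E D)
    = 2 * (real q + 1) + ((real q)^2 - 1) * of_bool (C = D) - 2 * tang C D - 2 * meet C D"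
proof -
  have C: "C \<in> \<C>" and D: "D \<in> \<C>" and cl: "cls C = cls D" 
    using assms by (auto simp: mates_def)
  define n where "n R = (\<Sum>E\<in>mates C0. of_bool (E \<inter> C = {R}) * tang E D)" for R
  have n: "n R = real (card {E \<in> \<C>. E \<inter> C = {R} \<and> card (E \<inter> D) = 1})" if "R \<in> C" for R
  proof -
    have "n R = real (card {E \<in> mates C0. E \<inter> C = {R} \<and> card (E \<inter> D) = 1})"
      unfolding n_def tang_def using fin_mates by (simp add: Int_Collect_eq flip: of_bool_conj)
    also have "{E \<in> mates C0. E \<inter> C = {R} \<and> card (E \<inter> D) = 1} = {E \<in> \<C>. E \<inter> C = {R} \<and> card (E \<inter> D) = 1}"
      using class_touch_count(1)[OF assms(1,2) that] by blast
    finally show ?thesis .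
  qed
  \<comment> \<open>\<open>C\<close> belongs to the pencil counted by \<open>pencil_two\<close>, but
    not to the circles touching \<open>C\<close> that \<open>n\<close> counts.\<close>
  have cc: "C \<inter> C \<noteq> {R}" for R
  proof
    assume "C \<inter> C = {R}"
    hence "card C = 1" by simp
    thus False using circ_card[OF C] q_gt3 by simp
  qed
  have out: "n R = 2 - tang C D" if R: "R \<in> C" "R \<notin> D" for R
  proof -
    let ?A = "{E \<in> \<C>. E \<inter> C = {R} \<and> card (E \<inter> D) = 1}"
    let ?B = "{E \<in> \<C>. (E = C \<or> E \<inter> C = {R}) \<and> card (E \<inter> D) = 1}"
    have B: "card ?B = 2" using pencil_two[OF C D cl R] .
    show ?thesis
    proof (cases "card (C \<inter> D) = 1")
      case True
      have "?B = insert C ?A" using True C by auto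
      moreover have "C \<notin> ?A" using cc by auto
      ultimately have "card ?B = Suc (card ?A)" using fin_circles by simp
      thus ?thesis using B n[OF R(1)] True by (simp add: tang_def)
    next
      case False
      have "?B = ?A" using False by auto
      thus ?thesis using B n[OF R(1)] False by (simp add: tang_def)
    qed
  qed
  have "(\<Sum>E\<in>mates C0. tang C E * tang E D) = (\<Sum>R\<in>C. n R)"
    by (simp add: sum_tang_weighted[OF C] n_def)
  also have "\<dots> = (\<Sum>R\<in>C - D. n R) + (\<Sum>R\<in>C \<inter> D. n R)"
    using fin_circ[OF C] by (metis add.commute sum.Int_Diff)
  also have "(\<Sum>R\<in>C - D. n R) = ((real q + 1) - meet C D) * (2 - tang C D)"
  proof -
    have "real (card (C - D)) = (real q + 1) - meet C D"
      using circ_card[OF C] fin_circ[OF C] card_Int_Diff[of C D] by (simp add: meet_def)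
    thus ?thesis using out by simp
  qed
  finally have main: "(\<Sum>E\<in>mates C0. tang C E * tang E D)
    = ((real q + 1) - meet C D) * (2 - tang C D) + (\<Sum>R\<in>C \<inter> D. n R)" .
  consider "C = D" | "C \<noteq> D" "card (C \<inter> D) = 0" | "C \<noteq> D" "card (C \<inter> D) = 1" | "C \<noteq> D" "card (C \<inter> D) = 2"
    using inter_le_2[OF C D] by fastforce
  thus ?thesis
  proof cases
    case 1
    have t0: "tang C D = 0" and m: "meet C D = real q + 1"
      using 1 circ_card[OF C] q_gt3 by (simp_all add: tang_def meet_def)
    have "n R = real q - 1" if R: "R \<in> C \<inter> D" for R
    proof -
      have "{E \<in> \<C>. E \<inter> C = {R} \<and> card (E \<inter> D) = 1} = {E \<in> \<C>. E \<inter> C = {R}}"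
        using 1 by auto
      thus ?thesis using n[of R] R touch_count[OF C, of R] q_gt3 by simp
    qed
    hence "(\<Sum>R\<in>C \<inter> D. n R) = (\<Sum>R\<in>C \<inter> D. real q - 1)" by (rule sum.cong[OF refl])
    also have "\<dots> = (real q)^2 - 1"
      using 1 circ_card[OF C] by (simp add: power2_eq_square algebra_simps)
    finally show ?thesis using main t0 m 1 by simp
  next
    case 2
    hence "C \<inter> D = {}" using fin_circ[OF C] by simp
    thus ?thesis using main 2 by (simp add: tang_def meet_def)
  next
    case 3
    then obtain R where R: "C \<inter> D = {R}" by (auto simp: card_1_singleton_iff)
    have t0: "tang C D = 1" and m: "meet C D = 1" using 3 by (simp_all add: tang_def meet_def)
    have RC: "R \<in> C" "R \<in> D" using R by blast+
    let ?A = "{E \<in> \<C>. E \<inter> C = {R} \<and> card (E \<inter> D) = 1}"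
    have DC: "D \<inter> C = {R}" using R by (simp add: Int_commute)
    have A: "E \<in> ?A \<longleftrightarrow> E \<in> {E \<in> \<C>. E \<inter> C = {R}} - {D}" for E
    proof
      assume E: "E \<in> ?A"
      have "card (D \<inter> D) \<noteq> 1" using circ_card[OF D] q_gt3 by simp
      hence "E \<noteq> D" using E by blast
      thus "E \<in> {E \<in> \<C>. E \<inter> C = {R}} - {D}" using E by simp
    next
      assume E: "E \<in> {E \<in> \<C>. E \<inter> C = {R}} - {D}"
      hence "E \<inter> D = {R}" using touch_trans[OF C RC(1) D DC, of E] by simp
      thus "E \<in> ?A" using E by simp
    qed
    have "?A = {E \<in> \<C>. E \<inter> C = {R}} - {D}" using A by (intro set_eqI)
    moreover have "D \<in> {E \<in> \<C>. E \<inter> C = {R}}" using D DC by simp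
    \<comment> \<open>The second \<open>- 1\<close> removes \<open>D\<close>: it touches
      \<open>C\<close> at \<open>R\<close> but is not tangent to itself.\<close>
    ultimately have "card ?A = (q - 1) - 1"
      using touch_count[OF C RC(1)] fin_circles by (simp only: card_Diff_singleton)
    hence "n R = real q - 2" using n[OF RC(1)] q_gt3 by simp
    thus ?thesis using main R t0 m 3 by simp
  next
    case 4
    have t0: "tang C D = 0" and m: "meet C D = 2" using 4 by (simp_all add: tang_def meet_def)
    have "n R = 0" if R: "R \<in> C \<inter> D" for R
    proof -
      \<comment> \<open>A circle touching both at \<open>R\<close> would force them to touch each
        other, although they share two points.\<close>
      have "False" if E: "E \<in> \<C>" "E \<inter> C = {R}" "card (E \<inter> D) = 1" for E
      proof -
        have RE: "R \<in> E" using E(2) by blast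
        hence ED: "E \<inter> D = {R}" using E(3) R card_eq_1_iff[of R "E \<inter> D"] by simp
        have "C \<inter> E = {R}" "D \<inter> E = {R}" using E(2) ED by (simp_all add: Int_commute)
        hence "D \<inter> C = {R}" using touch_trans[OF E(1) RE C _ D] 4 by auto
        thus False using 4 by (simp add: Int_commute)
      qed
      hence "{E \<in> \<C>. E \<inter> C = {R} \<and> card (E \<inter> D) = 1} = {}" by blast
      hence "card {E \<in> \<C>. E \<inter> C = {R} \<and> card (E \<inter> D) = 1} = 0" by (simp only: card.empty)
      thus ?thesis using n[of R] R by simp
    qed
    thus ?thesis using main t0 m 4 by simp
  qed
qed

text \<open>Up to the factor \<open>2 q (q - 1)\<close> this kernel is the orthogonal projection onto the
  eigenspace of the tangency graph for its least eigenvalue \<open>- q - 1\<close>.\<close>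

definition proj :: "'p set \<Rightarrow> 'p set \<Rightarrow> real" where
  "proj C D = (real q - 1) * ((real q - 1) * of_bool (C = D) - tang C D) - 2 * (meet C D - 2)"

text \<open>On vectors orthogonal to all stars of the class, \<open>T^2 + 2 T = (q^2 - 1) I\<close>,
  so \<open>T\<close> has eigenvalues q - 1 and -q - 1 there. On star combinations of total weight
  zero \<open>T\<close> is -2 and \<open>G\<close> is (q^2 - 1) / 2. The kernel is built to vanish
  on these, on the constant vector and at the eigenvalue q - 1; at -q - 1 it takes the value 2 q (q
  - 1).\<close>

lemma proj_square:
  assumes "C0 \<in> \<C>" "C \<in> mates C0" "D \<in> mates C0"
  shows "(\<Sum>E\<in>mates C0. proj C E * proj E D) = 2 * real q * (real q - 1) * proj C D"
proof -
  define r where "r = real q"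
  have d1: "(\<Sum>E\<in>mates C0. of_bool (C = E) * h E) = h C" for h :: "_ \<Rightarrow> real"
    using assms fin_mates by (simp add: of_bool_def if_distrib if_distribR cong: if_cong)
  have d2: "(\<Sum>E\<in>mates C0. h E * of_bool (E = D)) = h D" for h :: "_ \<Rightarrow> real"
    using assms fin_mates by (simp add: of_bool_def if_distrib if_distribR cong: if_cong)
  have mD: "2 * (\<Sum>E\<in>mates C0. meet E D) = r * (r + 1)^2"
    using sum_meet[OF assms(1,3)] by (simp add: r_def meet_commute[of _ D])
  have mC: "2 * (\<Sum>E\<in>mates C0. meet C E) = r * (r + 1)^2"
    using sum_meet[OF assms(1,2)] by (simp add: r_def)
  have tC: "(\<Sum>E\<in>mates C0. tang C E) = r^2 - 1" using sum_tang[OF assms(1,2)] by (simp add: r_def)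
  have tD: "(\<Sum>E\<in>mates C0. tang E D) = r^2 - 1"
    using sum_tang[OF assms(1,3)] by (simp add: r_def tang_commute[of _ D])
  have tm: "(\<Sum>E\<in>mates C0. tang C E * meet E D) = (r + 1)^2 - 2 * meet C D"
    using sum_tang_meet[OF assms] by (simp add: r_def)
  have mt: "(\<Sum>E\<in>mates C0. meet C E * tang E D) = (r + 1)^2 - 2 * meet C D"
    using sum_tang_meet[OF assms(1,3,2)]
    by (simp add: r_def mult.commute meet_commute tang_commute)
  have mm: "2 * (\<Sum>E\<in>mates C0. meet C E * meet E D) = (r^2 - 1) * meet C D + (r + 1)^3"
    using sum_meet_meet[OF assms] by (simp add: r_def)
  have tt: "(\<Sum>E\<in>mates C0. tang C E * tang E D)
      = 2 * (r + 1) + (r^2 - 1) * of_bool (C = D) - 2 * tang C D - 2 * meet C D"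
    using sum_tang_tang[OF assms] by (simp add: r_def)
  have k: "2 * (\<Sum>E\<in>mates C0. (1::real)) = r * (r^2 + 1)"
    using class_card[OF assms(1)] by (simp add: r_def)
  \<comment> \<open>Expanded so that each sum occurs in a form evaluated above; the factors 2 kept
    next to \<open>meet C E * meet E D\<close>, \<open>meet\<close> and \<open>1\<close> are those
    with which these sums over a class are known.\<close>
  have "(\<Sum>E\<in>mates C0. proj C E * proj E D) =
     (\<Sum>E\<in>mates C0. (r - 1)^2 * (of_bool (C = E) * ((r - 1)^2 * of_bool (E = D) - (r - 1) * tang E D))
       - (r - 1)^3 * (tang C E * of_bool (E = D)) + (r - 1)^2 * (tang C E * tang E D)
       - 2 * (r - 1)^2 * (of_bool (C = E) * (meet E D - 2)) - 2 * (r - 1)^2 * ((meet C E - 2) * of_bool (E = D))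
       + 2 * (r - 1) * (tang C E * meet E D) + 2 * (r - 1) * (meet C E * tang E D)
       - 4 * (r - 1) * tang C E - 4 * (r - 1) * tang E D
       + 2 * (2 * (meet C E * meet E D)) - 4 * (2 * meet C E) - 4 * (2 * meet E D) + 8 * (2 * 1))"
  proof (intro sum.cong refl)
    fix E
    define a b c d e f where "a = (of_bool (C = E) :: real)" and "b = (of_bool (E = D) :: real)"
      and "c = tang C E" and "d = tang E D" and "e = meet C E" and "f = meet E D"
    show "proj C E * proj E D = (r - 1)^2 * (of_bool (C = E) * ((r - 1)^2 * of_bool (E = D) - (r - 1) * tang E D))
       - (r - 1)^3 * (tang C E * of_bool (E = D)) + (r - 1)^2 * (tang C E * tang E D)
       - 2 * (r - 1)^2 * (of_bool (C = E) * (meet E D - 2)) - 2 * (r - 1)^2 * ((meet C E - 2) * of_bool (E = D))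
       + 2 * (r - 1) * (tang C E * meet E D) + 2 * (r - 1) * (meet C E * tang E D)
       - 4 * (r - 1) * tang C E - 4 * (r - 1) * tang E D
       + 2 * (2 * (meet C E * meet E D)) - 4 * (2 * meet C E) - 4 * (2 * meet E D) + 8 * (2 * 1)"
      unfolding proj_def r_def[symmetric] a_def[symmetric] b_def[symmetric] c_def[symmetric]
        d_def[symmetric] e_def[symmetric] f_def[symmetric]
      by algebra
  qed
  also have "\<dots> = (r - 1)^2 * ((r - 1)^2 * of_bool (C = D) - (r - 1) * tang C D)
       - (r - 1)^3 * tang C D + (r - 1)^2 * (2 * (r + 1) + (r^2 - 1) * of_bool (C = D) - 2 * tang C D - 2 * meet C D)
       - 2 * (r - 1)^2 * (meet C D - 2) - 2 * (r - 1)^2 * (meet C D - 2)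
       + 2 * (r - 1) * ((r + 1)^2 - 2 * meet C D) + 2 * (r - 1) * ((r + 1)^2 - 2 * meet C D)
       - 4 * (r - 1) * (r^2 - 1) - 4 * (r - 1) * (r^2 - 1)
       + 2 * ((r^2 - 1) * meet C D + (r + 1)^3) - 4 * (r * (r + 1)^2) - 4 * (r * (r + 1)^2)
       + 8 * (r * (r^2 + 1))"
    unfolding sum.distrib sum_subtractf sum_distrib_left[symmetric] d1 d2 tt tm mt mm tC tD mC mD k
    by (rule refl)
  also have "\<dots> = 2 * r * (r - 1) * proj C D"
    unfolding proj_def r_def[symmetric] by algebra
  finally show ?thesis by (simp add: r_def)
qed

text \<open>A symmetric matrix whose square is a positive multiple of itself has a quadratic form
  that is a positive multiple of a sum of squares.\<close>

lemma proj_nonneg: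
  assumes "C0 \<in> \<C>" "G \<subseteq> mates C0"
  shows "(\<Sum>C\<in>G. \<Sum>D\<in>G. proj C D) \<ge> 0"
proof -
  have sym: "proj C D = proj D C" for C D
    by (simp add: proj_def meet_commute tang_commute eq_commute)
  let ?c = "2 * real q * (real q - 1)"
  have "?c * (\<Sum>C\<in>G. \<Sum>D\<in>G. proj C D)
      = (\<Sum>C\<in>G. \<Sum>D\<in>G. \<Sum>E\<in>mates C0. proj C E * proj E D)"
    using assms proj_square[OF assms(1)] by (simp add: sum_distrib_left subset_iff)
  also have "\<dots> = (\<Sum>C\<in>G. \<Sum>E\<in>mates C0. \<Sum>D\<in>G. proj C E * proj E D)"
    by (intro sum.cong refl sum.swap)
  also have "\<dots> = (\<Sum>E\<in>mates C0. \<Sum>C\<in>G. \<Sum>D\<in>G. proj C E * proj E D)" by (rule sum.swap)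
  also have "\<dots> = (\<Sum>E\<in>mates C0. (\<Sum>D\<in>G. proj E D)^2)"
    by (simp add: power2_eq_square sum_product sym)
  also have "\<dots> \<ge> 0" by (intro sum_nonneg) simp
  finally have "?c * 0 \<le> ?c * (\<Sum>C\<in>G. \<Sum>D\<in>G. proj C D)" by simp
  moreover have "?c > 0" using q_gt3 by simp
  ultimately show ?thesis by (rule mult_left_le_imp_le)
qed

lemma mates_eq_iff: "C \<in> \<C> \<Longrightarrow> mates C = mates D \<longleftrightarrow> C \<in> mates D"
  by (auto simp: mates_def)

lemma two_count_real:
  assumes "P \<in> X" "R \<in> X"
  shows "real (card {C \<in> \<C>. P \<in> C \<and> R \<in> C}) = (real q + 1) + of_bool (P = R) * ((real q)^2 - 1)"
proof (cases "P = R")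
  case True
  thus ?thesis using one_count[OF assms(1)] by (simp add: power2_eq_square algebra_simps)
next
  case False
  thus ?thesis using two_count[OF assms False] by simp
qed

text \<open>Intersecting circles of different classes share exactly two points, so the kernel
  \<open>(q - 3) (meet - 2)\<close> vanishes there; inside a class it agrees with \<open>proj\<close> on intersecting circles.\<close>

lemma intersecting_meet:
  assumes F: "F \<subseteq> \<C>" and int: "\<And>C D. C \<in> F \<Longrightarrow> D \<in> F \<Longrightarrow> C \<inter> D \<noteq> {}"
  shows "(\<Sum>C\<in>F. \<Sum>D\<in>F. meet C D) \<ge> 2 * (real (card F))^2"
proof -
  have finF: "finite F" using F fin_circles finite_subset by blast
  have key: "(real q - 3) * (meet C D - 2) = (if D \<in> mates C then proj C D else 0)"
    if CD: "C \<in> F" "D \<in> F" for C D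
  proof (cases "C = D")
    case True
    have "card C = q + 1" "D \<in> mates C" using CD F circ_card True by (auto simp: mates_def)
    thus ?thesis using True q_gt3
      by (simp add: proj_def meet_def tang_def) (simp add: algebra_simps)
  next
    case False
    have mates: "C \<in> \<C>" "D \<in> \<C>" using CD F by auto
    have "card (C \<inter> D) \<noteq> 0" using int[OF CD] fin_circ mates by simp
    then consider "card (C \<inter> D) = 1" | "card (C \<inter> D) = 2"
      using inter_le_2[OF mates False] by linarith
    thus ?thesis
    proof cases
      case 1
      hence "D \<in> mates C" using cls_tangent[OF mates] mates by (simp add: mates_def Int_commute)
      thus ?thesis using 1 False by (simp add: proj_def meet_def tang_def)
    next
      case 2
      thus ?thesis using False by (simp add: proj_def meet_def tang_def)
    qed
  qed
  have "(real q - 3) * ((\<Sum>C\<in>F. \<Sum>D\<in>F. meet C D) - 2 * (real (card F))^2)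
     = (\<Sum>C\<in>F. \<Sum>D\<in>F. (real q - 3) * (meet C D - 2))"
    by (simp add: sum_subtractf power2_eq_square flip: sum_distrib_left)
  also have "\<dots> = (\<Sum>C\<in>F. \<Sum>D\<in>F \<inter> mates C. proj C D)"
    using key finF by (simp add: sum.inter_restrict)
  \<comment> \<open>Semidefiniteness is available class by class, so the surviving pairs are grouped
    by their common class.\<close>
  also have "\<dots> = (\<Sum>k\<in>mates ` F. \<Sum>C\<in>{C \<in> F. mates C = k}. \<Sum>D\<in>F \<inter> mates C. proj C D)"
    by (rule sum.image_gen[OF finF])
  also have "\<dots> \<ge> 0"
  proof (rule sum_nonneg)
    fix k assume "k \<in> mates ` F"
    then obtain C0 where C0: "C0 \<in> F" "k = mates C0" by auto
    have "{C \<in> F. mates C = k} = F \<inter> mates C0" using C0 F mates_eq_iff by auto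
    hence "(\<Sum>C\<in>{C \<in> F. mates C = k}. \<Sum>D\<in>F \<inter> mates C. proj C D)
        = (\<Sum>C\<in>F \<inter> mates C0. \<Sum>D\<in>F \<inter> mates C0. proj C D)"
      using C0 by (intro sum.cong) auto
    also have "\<dots> \<ge> 0" using C0 F by (intro proj_nonneg[of C0]) auto
    finally show "(\<Sum>C\<in>{C \<in> F. mates C = k}. \<Sum>D\<in>F \<inter> mates C. proj C D) \<ge> 0" .
  qed
  finally show ?thesis using q_gt3 by (simp add: zero_le_mult_iff)
qed

text \<open>Here \<open>w\<close> stands for the coefficient of a star in the case of equality, and
  the bounds express that a degree lies between 0 and q (q + 1). The lower one gives w \<ge> -1 / (r
  - 1), which exceeds -1/2 because r > 3.\<close>

lemma half_integer_cases:
  fixes r w :: real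
  assumes r: "r > 3" and half: "2 * w \<in> \<int>" and lo: "- (r + 1) \<le> (r^2 - 1) * w"
    and hi: "(r^2 - 1) * w \<le> r^2 - 1"
  shows "2 * w \<in> {0, 1, 2}"
proof -
  obtain k where k: "2 * w = of_int k" using half by (rule Ints_cases)
  have sq: "r^2 - 1 = (r + 1) * (r - 1)" by (simp add: power2_eq_square algebra_simps)
  have pos: "0 < r + 1" "0 < r - 1" using r by simp_all
  have "(r + 1) * (-1) \<le> (r + 1) * ((r - 1) * w)" using lo unfolding sq by (simp add: mult.assoc)
  hence 1: "-1 \<le> (r - 1) * w" using pos(1) by (rule mult_left_le_imp_le)
  have "(r - 1) * (-1/2) < -1" using r by simp
  hence "(r - 1) * (-1/2) < (r - 1) * w" using 1 by (rule less_le_trans)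
  hence "-1/2 < w" by (rule mult_left_less_imp_less) (use pos in simp)
  hence "k > -1" using k by linarith
  moreover have "(r^2 - 1) * w \<le> (r^2 - 1) * 1" using hi by simp
  hence "w \<le> 1" by (rule mult_left_le_imp_le) (use pos in \<open>simp add: sq\<close>)
  hence "k \<le> 2" using k by linarith
  ultimately have "k = 0 \<or> k = 1 \<or> k = 2" by linarith
  thus ?thesis unfolding k by auto
qed

section \<open>Degrees of points and the least squares fit of a family by stars\<close>

definition deg :: "'p set set \<Rightarrow> 'p \<Rightarrow> real" where
  "deg F P = real (card {C \<in> F. P \<in> C})"

lemma sum_over_circle:
  assumes "C \<in> \<C>"
  shows "(\<Sum>P\<in>C. w P) = (\<Sum>P\<in>X. of_bool (P \<in> C) * (w P :: real))"
proof -
  have "(\<Sum>P\<in>X. of_bool (P \<in> C) * w P) = (\<Sum>P\<in>X. if P \<in> C then w P else 0)"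
    by (intro sum.cong) auto
  also have "\<dots> = (\<Sum>P\<in>X \<inter> C. w P)" using finX by (simp add: sum.inter_restrict)
  also have "X \<inter> C = C" using assms circ_sub by auto
  finally show ?thesis by simp
qed

lemma sum_circles:
  assumes F: "F \<subseteq> \<C>"
  shows "(\<Sum>C\<in>F. \<Sum>P\<in>C. w P) = (\<Sum>P\<in>X. deg F P * w P)"
proof -
  have finF: "finite F" using F fin_circles finite_subset by blast
  have "(\<Sum>C\<in>F. \<Sum>P\<in>C. w P) = (\<Sum>C\<in>F. \<Sum>P\<in>X. of_bool (P \<in> C) * w P)"
    using F by (intro sum.cong refl sum_over_circle) auto
  also have "\<dots> = (\<Sum>P\<in>X. \<Sum>C\<in>F. of_bool (P \<in> C) * w P)" by (rule sum.swap)
  also have "\<dots> = (\<Sum>P\<in>X. deg F P * w P)"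
    using finF by (simp add: deg_def Int_Collect_eq flip: sum_distrib_right)
  finally show ?thesis .
qed

lemma sum_deg:
  assumes F: "F \<subseteq> \<C>"
  shows "(\<Sum>P\<in>X. deg F P) = (real q + 1) * real (card F)"
proof -
  have "(\<Sum>P\<in>X. deg F P) = (\<Sum>C\<in>F. real (card C))" using sum_circles[OF F, of "\<lambda>_. 1"] by simp
  also have "\<dots> = (\<Sum>C\<in>F. real q + 1)" using F circ_card by (intro sum.cong) auto
  finally show ?thesis by simp
qed

text \<open>Both sides count triples of two members and a point common to them.\<close>

lemma sum_deg_square:
  assumes F: "F \<subseteq> \<C>"
  shows "(\<Sum>C\<in>F. \<Sum>D\<in>F. meet C D) = (\<Sum>P\<in>X. (deg F P)^2)"
proof -
  have finF: "finite F" using F fin_circles finite_subset by blast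
  have "(\<Sum>D\<in>F. meet C D) = (\<Sum>P\<in>C. deg F P)" if "C \<in> F" for C
  proof -
    have "(\<Sum>D\<in>F. meet C D) = (\<Sum>D\<in>F. \<Sum>P\<in>C. of_bool (P \<in> D))" using that F meet_sum by auto
    also have "\<dots> = (\<Sum>P\<in>C. \<Sum>D\<in>F. of_bool (P \<in> D))" by (rule sum.swap)
    also have "\<dots> = (\<Sum>P\<in>C. deg F P)" using finF by (simp add: deg_def Int_Collect_eq)
    finally show ?thesis .
  qed
  thus ?thesis using sum_circles[OF F, of "deg F"] by (simp add: power2_eq_square)
qed

text \<open>The right side is the quadratic form of the Gram matrix of the stars: two stars share q
  + 1 circles, and a single star has (q + 1) + (q^2 - 1).\<close>

lemma sum_circle_square:
  "(\<Sum>C\<in>\<C>. (\<Sum>P\<in>C. w P)^2) = (real q + 1) * (\<Sum>P\<in>X. w P)^2 + ((real q)^2 - 1) * (\<Sum>P\<in>X. (w P)^2)"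
proof -
  have "(\<Sum>C\<in>\<C>. (\<Sum>P\<in>C. w P)^2)
      = (\<Sum>C\<in>\<C>. \<Sum>P\<in>X. \<Sum>R\<in>X. of_bool (P \<in> C \<and> R \<in> C) * (w P * w R))"
    by (intro sum.cong refl) (simp add: sum_over_circle power2_eq_square sum_product of_bool_conj mult_ac)
  also have "\<dots> = (\<Sum>P\<in>X. \<Sum>C\<in>\<C>. \<Sum>R\<in>X. of_bool (P \<in> C \<and> R \<in> C) * (w P * w R))"
    by (rule sum.swap)
  also have "\<dots> = (\<Sum>P\<in>X. \<Sum>R\<in>X. \<Sum>C\<in>\<C>. of_bool (P \<in> C \<and> R \<in> C) * (w P * w R))"
    by (intro sum.cong refl sum.swap)
  also have "\<dots> = (\<Sum>P\<in>X. \<Sum>R\<in>X. (real q + 1) * (w P * w R) + of_bool (P = R) * (((real q)^2 - 1) * (w P * w R)))"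
  proof (intro sum.cong refl)
    fix P R assume PR: "P \<in> X" "R \<in> X"
    have "(\<Sum>C\<in>\<C>. of_bool (P \<in> C \<and> R \<in> C) * (w P * w R))
       = real (card {C \<in> \<C>. P \<in> C \<and> R \<in> C}) * (w P * w R)"
      using fin_circles by (simp add: Int_Collect_eq flip: sum_distrib_right)
    thus "(\<Sum>C\<in>\<C>. of_bool (P \<in> C \<and> R \<in> C) * (w P * w R))
       = (real q + 1) * (w P * w R) + of_bool (P = R) * (((real q)^2 - 1) * (w P * w R))"
      using two_count_real[OF PR] by (simp add: algebra_simps)
  qed
  also have "\<dots> = (\<Sum>P\<in>X. (real q + 1) * (w P * (\<Sum>R\<in>X. w R)) + ((real q)^2 - 1) * (w P * w P))"
  proof (intro sum.cong refl)
    fix P assume "P \<in> X"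
    hence "(\<Sum>R\<in>X. of_bool (P = R) * (((real q)^2 - 1) * (w P * w R))) = ((real q)^2 - 1) * (w P * w P)"
      using finX by (simp add: of_bool_def if_distrib if_distribR cong: if_cong)
    thus "(\<Sum>R\<in>X. (real q + 1) * (w P * w R) + of_bool (P = R) * (((real q)^2 - 1) * (w P * w R)))
        = (real q + 1) * (w P * (\<Sum>R\<in>X. w R)) + ((real q)^2 - 1) * (w P * w P)"
      by (simp add: sum.distrib sum_distrib_left)
  qed
  also have "\<dots> = (real q + 1) * (\<Sum>P\<in>X. w P)^2 + ((real q)^2 - 1) * (\<Sum>P\<in>X. (w P)^2)"
    by (simp add: sum.distrib power2_eq_square sum_distrib_right flip: sum_distrib_left)
  finally show ?thesis .
qed

text \<open>The coefficients of the orthogonal projection of the indicator of \<open>F\<close> onto the span of the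
  stars, that is, of the sets of circles through a point.\<close>

definition wt :: "'p set set \<Rightarrow> 'p \<Rightarrow> real" where
  "wt F P = (deg F P - real (card F) / real q) / ((real q)^2 - 1)"

lemma q2_pos: "(real q)^2 - 1 > 0"
proof -
  have "1 < real q" using q_gt3 by simp
  thus ?thesis by (simp add: one_less_power)
qed

text \<open>The normal equations of the projection are (q^2 - 1) w(P) + (q + 1) V = deg(P), with V
  the total weight. Adding them over all points yields V, and inserting V yields the formula for
  \<open>wt\<close>. The total is the ratio of \<open>card F\<close> to the bound.\<close>

lemma sum_wt:
  assumes "F \<subseteq> \<C>"
  shows "(\<Sum>P\<in>X. wt F P) = real (card F) / (real q * (real q + 1))"
proof -
  let ?r = "real q" and ?s = "real (card F)"
  have r: "?r > 3" using q_gt3 by simp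
  have "(\<Sum>P\<in>X. wt F P) = ((?r + 1) * ?s - (?r^2 + 1) * (?s / ?r)) / (?r^2 - 1)"
    using sum_deg[OF assms] cardX
    by (simp add: wt_def sum_subtractf algebra_simps flip: sum_divide_distrib)
  also have "(?r + 1) * ?s - (?r^2 + 1) * (?s / ?r) = ?s / (?r * (?r + 1)) * (?r^2 - 1)"
  proof -
    have "?r \<noteq> 0" "?r + 1 \<noteq> 0" using r by linarith+
    thus ?thesis by (simp add: divide_simps) algebra
  qed
  also have "\<dots> / (?r^2 - 1) = ?s / (?r * (?r + 1))" using q2_pos by simp
  finally show ?thesis .
qed

lemma wt_residual:
  assumes F: "F \<subseteq> \<C>"
  shows "(\<Sum>C\<in>\<C>. (of_bool (C \<in> F) - (\<Sum>P\<in>C. wt F P))^2)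
    = real (card F) - ((\<Sum>P\<in>X. (deg F P)^2) - (real q + 1) * (real (card F))^2 / real q) / ((real q)^2 - 1)"
proof -
  let ?r = "real q" and ?s = "real (card F)" and ?V = "\<Sum>P\<in>X. wt F P"
  let ?W = "\<Sum>P\<in>X. deg F P * wt F P"
  have r: "?r > 3" using q_gt3 by simp
  have "(\<Sum>C\<in>\<C>. (of_bool (C \<in> F) - (\<Sum>P\<in>C. wt F P))^2)
      = (\<Sum>C\<in>\<C>. of_bool (C \<in> F)) - 2 * (\<Sum>C\<in>\<C>. of_bool (C \<in> F) * (\<Sum>P\<in>C. wt F P))
        + (\<Sum>C\<in>\<C>. (\<Sum>P\<in>C. wt F P)^2)"
  proof -
    have "(of_bool (C \<in> F) - y)^2 = of_bool (C \<in> F) - 2 * (of_bool (C \<in> F) * y) + y^2"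
      for C and y :: real
      by (simp add: of_bool_def power2_eq_square algebra_simps)
    thus ?thesis by (simp add: sum.distrib sum_subtractf flip: sum_distrib_left)
  qed
  also have "(\<Sum>C\<in>\<C>. of_bool (C \<in> F) :: real) = ?s"
  proof -
    have "\<C> \<inter> {C. C \<in> F} = F" using F by auto
    thus ?thesis using fin_circles by simp
  qed
  also have "(\<Sum>C\<in>\<C>. of_bool (C \<in> F) * (\<Sum>P\<in>C. wt F P)) = ?W"
  proof -
    have "(\<Sum>C\<in>\<C>. of_bool (C \<in> F) * (\<Sum>P\<in>C. wt F P)) = (\<Sum>C\<in>\<C>. if C \<in> F then (\<Sum>P\<in>C. wt F P) else 0)"
      by (intro sum.cong) auto
    also have "\<dots> = (\<Sum>C\<in>\<C> \<inter> F. \<Sum>P\<in>C. wt F P)" using fin_circles by (simp add: sum.inter_restrict)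
    also have "\<C> \<inter> F = F" using F by auto
    finally show ?thesis using sum_circles[OF F] by simp
  qed
  also have "(\<Sum>C\<in>\<C>. (\<Sum>P\<in>C. wt F P)^2) = (?r + 1) * ?V^2 + (?r^2 - 1) * (\<Sum>P\<in>X. (wt F P)^2)"
    by (rule sum_circle_square)
  also have "(?r^2 - 1) * (\<Sum>P\<in>X. (wt F P)^2) = ?W - ?s / ?r * ?V"
  proof -
    have "(?r^2 - 1) * (wt F P)^2 = deg F P * wt F P - ?s / ?r * wt F P" for P
    proof -
      have "(?r^2 - 1) * wt F P = deg F P - ?s / ?r" using q2_pos by (simp add: wt_def)
      hence "(?r^2 - 1) * wt F P * wt F P = (deg F P - ?s / ?r) * wt F P" by (rule arg_cong)
      thus ?thesis by (simp only: power2_eq_square left_diff_distrib mult.assoc)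
    qed
    thus ?thesis by (simp add: sum_distrib_left sum_subtractf)
  qed
  \<comment> \<open>The residual is orthogonal to the fit: the squared norm of the fit equals its
    inner product \<open>?W\<close> with the indicator, so the expansion collapses to
    \<open>card F - ?W\<close>.\<close>
  also have "(?r + 1) * ?V^2 + (?W - ?s / ?r * ?V) = ?W"
  proof -
    have "?r + 1 \<noteq> 0" "?r \<noteq> 0" using r by linarith+
    thus ?thesis unfolding sum_wt[OF F] by (simp add: divide_simps power2_eq_square)
  qed
  also have "?W = ((\<Sum>P\<in>X. (deg F P)^2) - ?s / ?r * (\<Sum>P\<in>X. deg F P)) / (?r^2 - 1)"
    by (simp add: wt_def power2_eq_square right_diff_distrib sum_subtractf sum_distrib_left mult_ac
          flip: sum_divide_distrib)
  finally show ?thesis unfolding sum_deg[OF F] by (simp add: power2_eq_square mult_ac)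
qed

text \<open>Degree squares summing to at least 2 s^2 leave the fit at least (2 - (q + 1) / q) s^2 /
  (q^2 - 1) = s^2 / (q (q + 1)) of the squared norm s of the indicator. That the residual is
  nonnegative is then the bound on s, and an extremal s forces it to vanish.\<close>

lemma residual_bound:
  assumes F: "F \<subseteq> \<C>" and int: "\<And>C D. C \<in> F \<Longrightarrow> D \<in> F \<Longrightarrow> C \<inter> D \<noteq> {}"
  shows "(\<Sum>C\<in>\<C>. (of_bool (C \<in> F) - (\<Sum>P\<in>C. wt F P))^2)
    \<le> real (card F) - (real (card F))^2 / (real q * (real q + 1))"
proof -
  let ?r = "real q" and ?s = "real (card F)"
  have r: "?r > 3" using q_gt3 by simp
  have "2 * ?s^2 \<le> (\<Sum>P\<in>X. (deg F P)^2)"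
    using intersecting_meet[OF F int] sum_deg_square[OF F] by simp
  hence "(2 * ?s^2 - (?r + 1) * ?s^2 / ?r) / (?r^2 - 1)
      \<le> ((\<Sum>P\<in>X. (deg F P)^2) - (?r + 1) * ?s^2 / ?r) / (?r^2 - 1)"
    using q2_pos by (intro divide_right_mono) auto
  moreover have "(2 * ?s^2 - (?r + 1) * ?s^2 / ?r) / (?r^2 - 1) = ?s^2 / (?r * (?r + 1))"
  proof -
    have "?r \<noteq> 0" "?r + 1 \<noteq> 0" using r by linarith+
    hence "2 * ?s^2 - (?r + 1) * ?s^2 / ?r = ?s^2 / (?r * (?r + 1)) * (?r^2 - 1)"
      by (simp add: divide_simps) algebra
    thus ?thesis using q2_pos by simp
  qed
  ultimately show ?thesis using wt_residual[OF F] by simp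
qed

theorem intersecting_card_le:
  assumes F: "F \<subseteq> \<C>" and int: "\<And>C D. C \<in> F \<Longrightarrow> D \<in> F \<Longrightarrow> C \<inter> D \<noteq> {}"
  shows "card F \<le> q * (q + 1)"
proof -
  let ?r = "real q" and ?s = "real (card F)"
  have pos: "?r * (?r + 1) > 0" using q_gt3 by simp
  have "0 \<le> (\<Sum>C\<in>\<C>. (of_bool (C \<in> F) - (\<Sum>P\<in>C. wt F P))^2)" by (intro sum_nonneg) simp
  also have "\<dots> \<le> ?s - ?s^2 / (?r * (?r + 1))" by (rule residual_bound[OF F int])
  finally have "?s * ?s \<le> (?r * (?r + 1)) * ?s"
    using pos by (simp add: pos_divide_le_eq power2_eq_square mult.commute)
  hence "?s \<le> ?r * (?r + 1)"
    using pos mult_right_le_imp_le[of ?s ?s "?r * (?r + 1)"] by (cases "?s = 0") auto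
  hence "?s \<le> real (q * (q + 1))" by (simp add: distrib_left)
  thus ?thesis by (simp only: of_nat_le_iff)
qed

text \<open>The indicator of \<open>F\<close> is the combination of stars with weights
  \<open>wt F\<close>. Among the circles through \<open>P\<close> and \<open>R\<close>, the star of
  another point contains one, those of \<open>P\<close> and \<open>R\<close> contain all q + 1; the
  weights add up to 1 because \<open>F\<close> attains the bound.\<close>

lemma pair_degree:
  assumes F: "F \<subseteq> \<C>" and sF: "card F = q * (q + 1)"
    and fit: "\<And>C. C \<in> \<C> \<Longrightarrow> of_bool (C \<in> F) = (\<Sum>P\<in>C. wt F P)"
    and PR: "P \<in> X" "R \<in> X" "P \<noteq> R"
  shows "real (card {C \<in> F. P \<in> C \<and> R \<in> C}) = 1 + real q * (wt F P + wt F R)"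
proof -
  have V: "(\<Sum>P\<in>X. wt F P) = 1" using sum_wt[OF F] sF q2_pos q_gt3
    by (simp add: distrib_left) (metis add_pos_pos less_irrefl mult_pos_pos of_nat_0_less_iff gr_implies_not0 neq0_conv)
  let ?A = "{C \<in> \<C>. P \<in> C \<and> R \<in> C}"
  have A: "?A \<subseteq> \<C>" by blast
  have finA: "finite ?A" using fin_circles by simp
  have "?A \<inter> {C. C \<in> F} = {C \<in> F. P \<in> C \<and> R \<in> C}" using F by auto
  hence "real (card {C \<in> F. P \<in> C \<and> R \<in> C}) = (\<Sum>C\<in>?A. of_bool (C \<in> F))" using finA by simp
  also have "\<dots> = (\<Sum>C\<in>?A. \<Sum>S\<in>C. wt F S)" using fit by (intro sum.cong) auto
  also have "\<dots> = (\<Sum>S\<in>X. deg ?A S * wt F S)" by (rule sum_circles[OF A])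
  also have "\<dots> = (\<Sum>S\<in>X. wt F S + real q * (of_bool (S = P) * wt F S + of_bool (S = R) * wt F S))"
  proof (intro sum.cong refl)
    fix S assume S: "S \<in> X"
    have "{C \<in> ?A. S \<in> C} = ?A" if "S = P \<or> S = R" using that by auto
    hence 1: "deg ?A S = real q + 1" if "S = P \<or> S = R"
      using that two_count[OF PR] by (simp add: deg_def)
    have 2: "deg ?A S = 1" if SPR: "S \<noteq> P" "S \<noteq> R"
    proof -
      obtain C where "C \<in> \<C> \<and> P \<in> C \<and> R \<in> C \<and> S \<in> C"
        "\<And>D. D \<in> \<C> \<and> P \<in> D \<and> R \<in> D \<and> S \<in> D \<Longrightarrow> D = C"
        using three[of P R S] PR S SPR by blast
      hence "{C \<in> ?A. S \<in> C} = {C}" by blast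
      thus ?thesis by (simp add: deg_def)
    qed
    show "deg ?A S * wt F S = wt F S + real q * (of_bool (S = P) * wt F S + of_bool (S = R) * wt F S)"
      using 1 2 PR(3) by (cases "S = P"; cases "S = R") (auto simp: algebra_simps)
  qed
  also have "\<dots> = (\<Sum>S\<in>X. wt F S) + real q * ((\<Sum>S\<in>X. of_bool (S = P) * wt F S) + (\<Sum>S\<in>X. of_bool (S = R) * wt F S))"
    by (simp add: sum.distrib flip: sum_distrib_left)
  also have "(\<Sum>S\<in>X. of_bool (S = P) * wt F S) = wt F P"
    using PR finX by (simp add: of_bool_def if_distrib if_distribR cong: if_cong)
  also have "(\<Sum>S\<in>X. of_bool (S = R) * wt F S) = wt F R"
    using PR finX by (simp add: of_bool_def if_distrib if_distribR cong: if_cong)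
  finally show ?thesis using V by simp
qed

text \<open>Once the fit is exact its weights are rigid: each is 0, 1/2 or 1. A weight 1 means that
  the point has degree \<open>card F\<close>, so all of \<open>F\<close> passes through it. Without
  such a point, weights 1/2 and 0 both occur, and the pair count of two such points makes q / 2 an
  integer.\<close>

theorem intersecting_card_eq:
  assumes F: "F \<subseteq> \<C>" and int: "\<And>C D. C \<in> F \<Longrightarrow> D \<in> F \<Longrightarrow> C \<inter> D \<noteq> {}"
    and sF: "card F = q * (q + 1)"
  shows "\<exists>P\<in>X. F = {C \<in> \<C>. P \<in> C}"
proof -
  let ?r = "real q"
  have r: "?r > 3" using q_gt3 by simp
  have V: "(\<Sum>P\<in>X. wt F P) = 1" using sum_wt[OF F] sF q2_pos q_gt3
    by (simp add: distrib_left) (metis add_pos_pos less_irrefl mult_pos_pos of_nat_0_less_iff gr_implies_not0 neq0_conv)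
  have "(\<Sum>C\<in>\<C>. (of_bool (C \<in> F) - (\<Sum>P\<in>C. wt F P))^2) \<le> 0"
  proof -
    have "real (card F) = ?r * (?r + 1)" using sF by (simp add: distrib_left)
    moreover have "?r * (?r + 1) \<noteq> 0" using r by simp
    ultimately show ?thesis using residual_bound[OF F int] by (simp add: power2_eq_square)
  qed
  hence "(\<Sum>C\<in>\<C>. (of_bool (C \<in> F) - (\<Sum>P\<in>C. wt F P))^2) = 0"
    by (intro antisym sum_nonneg) simp_all
  hence fit: "of_bool (C \<in> F) = (\<Sum>P\<in>C. wt F P)" if "C \<in> \<C>" for C
    using that fin_circles by (simp add: sum_nonneg_eq_0_iff)
  have pair: "?r * (wt F P + wt F R) \<in> \<int>" if "P \<in> X" "R \<in> X" "P \<noteq> R" for P R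
  proof -
    have "?r * (wt F P + wt F R) = real (card {C \<in> F. P \<in> C \<and> R \<in> C}) - 1"
      using pair_degree[OF F sF fit that] by simp
    also have "\<dots> \<in> \<int>" by simp
    finally show ?thesis .
  qed
  have deg_wt: "(?r^2 - 1) * wt F P = deg F P - (?r + 1)" for P
  proof -
    have "real (card F) / ?r = ?r + 1" using sF r by (simp add: field_simps)
    thus ?thesis using q2_pos by (simp add: wt_def)
  qed
  have third: "\<exists>S\<in>X. S \<noteq> P \<and> S \<noteq> R" for P R
  proof (rule ccontr)
    assume "\<not> ?thesis"
    hence "card X \<le> card {P, R}" by (intro card_mono) auto
    also have "\<dots> \<le> 2" by (simp add: card_insert_if)
    finally have "q^2 \<le> 1" using cardX by simp
    thus False using q2_pos by (metis diff_gt_0_iff_gt not_less of_nat_1 of_nat_le_iff of_nat_power)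
  qed
  have half: "2 * wt F P \<in> \<int>" if P: "P \<in> X" for P
  proof -
    obtain R where R: "R \<in> X" "R \<noteq> P" using third by blast
    obtain S where S: "S \<in> X" "S \<noteq> P" "S \<noteq> R" using third by blast
    \<comment> \<open>Three pair sums over three distinct points isolate twice a single
      weight.\<close>
    have "?r * (2 * wt F P)
        = ?r * (wt F P + wt F R) + ?r * (wt F P + wt F S) - ?r * (wt F R + wt F S)"
      by (simp add: algebra_simps)
    also have "\<dots> \<in> \<int>"
      using P R S by (intro Ints_diff Ints_add pair) auto
    finally have 1: "?r * (2 * wt F P) \<in> \<int>" .
    have 2: "(?r^2 - 1) * wt F P \<in> \<int>" unfolding deg_wt deg_def by (intro Ints_diff Ints_add Ints_of_nat Ints_1)
    \<comment> \<open>The multiples q * (2 w) and (q^2 - 1) * w of a weight w are integers, and this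
      combination of them is 2 w.\<close>
    have "2 * wt F P = ?r * (?r * (2 * wt F P)) - 2 * ((?r^2 - 1) * wt F P)"
      by (simp add: algebra_simps power2_eq_square)
    also have "\<dots> \<in> \<int>"
      by (intro Ints_diff Ints_mult[OF Ints_of_nat] Ints_mult[OF Ints_numeral] 1 2)
    finally show ?thesis .
  qed
  have deg_le: "deg F P \<le> ?r * (?r + 1)" if "P \<in> X" for P
  proof -
    have "card {C \<in> F. P \<in> C} \<le> card {C \<in> \<C>. P \<in> C}"
      using F fin_circles by (intro card_mono) auto
    also have "\<dots> = q * (q + 1)" by (rule one_count[OF that])
    finally have "real (card {C \<in> F. P \<in> C}) \<le> real (q * (q + 1))" by (simp only: of_nat_le_iff)
    thus ?thesis by (simp add: deg_def distrib_left)
  qed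
  have cases: "2 * wt F P \<in> {0, 1, 2}" if P: "P \<in> X" for P
  proof (rule half_integer_cases[OF r half[OF P]])
    show "- (?r + 1) \<le> (?r^2 - 1) * wt F P" unfolding deg_wt by (simp add: deg_def)
    show "(?r^2 - 1) * wt F P \<le> ?r^2 - 1"
      unfolding deg_wt using deg_le[OF P] by (simp add: distrib_left power2_eq_square)
  qed
  show ?thesis
  proof (cases "\<exists>P\<in>X. wt F P = 1")
    case True
    then obtain P where P: "P \<in> X" "wt F P = 1" by blast
    have "deg F P = ?r * (?r + 1)" using deg_wt[of P] P by (simp add: power2_eq_square algebra_simps)
    hence "real (card {C \<in> F. P \<in> C}) = real (q * (q + 1))" by (simp add: deg_def distrib_left)
    hence c: "card {C \<in> F. P \<in> C} = q * (q + 1)" by (simp only: of_nat_eq_iff)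
    have finF: "finite F" using F fin_circles finite_subset by blast
    have "{C \<in> F. P \<in> C} = F" by (intro card_subset_eq finF) (use c sF in auto)
    moreover have "{C \<in> F. P \<in> C} = {C \<in> \<C>. P \<in> C}"
      by (intro card_subset_eq) (use c one_count[OF P(1)] fin_circles F in auto)
    ultimately show ?thesis using P by auto
  next
    case False
    hence c: "wt F P = 0 \<or> wt F P = 1/2" if "P \<in> X" for P using cases[OF that] that by auto
    have "\<exists>P\<in>X. wt F P = 1/2"
    proof (rule ccontr)
      assume "\<not> ?thesis"
      hence "(\<Sum>P\<in>X. wt F P) = 0" using c by (intro sum.neutral) auto
      thus False using V by simp
    qed
    then obtain P where P: "P \<in> X" "wt F P = 1/2" by blast
    \<comment> \<open>Weight 1/2 at all q^2 + 1 points would exceed the total 1.\<close>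
    have "\<exists>R\<in>X. wt F R = 0"
    proof (rule ccontr)
      assume "\<not> ?thesis"
      hence "wt F R = 1/2" if "R \<in> X" for R using c that by auto
      hence "(\<Sum>P\<in>X. wt F P) = (\<Sum>P\<in>X. 1/2)" by (rule sum.cong[OF refl])
      also have "\<dots> = (?r^2 + 1) / 2" using cardX by simp
      finally show False using V q2_pos by simp
    qed
    then obtain R where R: "R \<in> X" "wt F R = 0" by blast
    have "?r * (wt F P + wt F R) \<in> \<int>" using P R by (intro pair) auto
    hence "?r / 2 \<in> \<int>" using P R by simp
    then obtain k where "?r / 2 = of_int k" by (rule Ints_cases)
    hence "?r = of_int (2 * k)" by simp
    hence "int q = 2 * k" by linarith
    thus ?thesis using odd_q by presburger
  qed
qed

end

section \<open>Linear algebra over a finite field of odd order\<close>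

text \<open>The factors cancel in pairs. It is applied to the shift by 1, to exclude characteristic
  two, and to inversion, for Wilson's theorem.\<close>

lemma prod_involution:
  fixes f :: "'b \<Rightarrow> 'c::comm_monoid_mult"
  assumes "finite A" "\<And>x. x \<in> A \<Longrightarrow> s x \<in> A" "\<And>x. x \<in> A \<Longrightarrow> s (s x) = x"
    "\<And>x. x \<in> A \<Longrightarrow> s x \<noteq> x" "\<And>x. x \<in> A \<Longrightarrow> f x * f (s x) = 1"
  shows "prod f A = 1"
  using assms
proof (induction A rule: finite_psubset_induct)
  case (psubset A)
  show ?case
  proof (cases "A = {}")
    case False
    then obtain x where x: "x \<in> A" by blast
    let ?B = "A - {x, s x}"
    have sub: "?B \<subset> A" using x by blast
    have "prod f ?B = 1"
    proof (rule psubset.IH[OF sub])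
      show "s y \<in> ?B" if "y \<in> ?B" for y
        using that psubset.prems(1,2) x by (metis DiffD1 DiffD2 DiffI insert_iff singleton_iff)
    qed (use psubset.prems in auto)
    moreover have "prod f A = f x * (f (s x) * prod f ?B)"
    proof -
      have "A = insert x (insert (s x) ?B)" using x psubset.prems(1) by blast
      hence "prod f A = prod f (insert x (insert (s x) ?B))" by simp
      also have "\<dots> = f x * prod f (insert (s x) ?B)"
        using psubset.hyps psubset.prems(3)[OF x] by (subst prod.insert) auto
      also have "\<dots> = f x * (f (s x) * prod f ?B)"
        using psubset.hyps by (subst prod.insert) auto
      finally show ?thesis .
    qed
    ultimately show ?thesis using psubset.prems(4)[OF x] by (simp add: mult.assoc[symmetric])
  qed simp
qed

text \<open>If 2 = 0, adding 1 is an involution without fixed points, so a product of factors -1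
  over the whole field is 1; an odd number of factors makes it -1.\<close>

lemma two_neq_zero:
  assumes "odd CARD('a::{field,finite})"
  shows "(2::'a) \<noteq> 0"
proof
  assume "(2::'a) = 0"
  hence "x + 1 + 1 = x" for x :: 'a by (simp add: add.assoc)
  hence "(\<Prod>x\<in>(UNIV::'a set). (-1::int)) = 1"
    by (intro prod_involution[where s = "\<lambda>x. x + 1"]) auto
  thus False using assms by simp
qed

text \<open>Inversion pairs off all nonzero elements except 1 and -1, which differ because 2 is
  nonzero.\<close>

lemma wilson:
  assumes "odd CARD('a::{field,finite})"
  shows "(\<Prod>x\<in>UNIV - {0}. x) = (-1 :: 'a)"
proof -
  have ne: "(1::'a) \<noteq> -1"
    using two_neq_zero[OF assms] by (metis one_add_one add.right_inverse)
  have "(\<Prod>x\<in>UNIV - {0, 1, -1}. x) = (1 :: 'a)"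
  proof (rule prod_involution[where s = inverse])
    show "inverse x \<noteq> x" if "x \<in> UNIV - {0, 1, -1}" for x :: 'a
    proof
      assume "inverse x = x"
      hence "x * x = 1" using that by (metis DiffD2 insertI1 right_inverse)
      hence "(x - 1) * (x + 1) = 0" by (simp add: algebra_simps)
      thus False using that by (auto simp: add_eq_0_iff2)
    qed
    show "inverse x \<in> UNIV - {0, 1, -1}" if "x \<in> UNIV - {0, 1, -1}" for x :: 'a
      using that by auto (metis inverse_inverse_eq inverse_minus_eq inverse_1)+
  qed auto
  moreover have "UNIV - {0::'a} = insert 1 (insert (-1) (UNIV - {0, 1, -1}))" by auto
  ultimately show ?thesis using ne by simp
qed

section \<open>Linear forms as coefficient vectors, and counting their common zeros\<close>

definition dot :: "('a::{field,finite}) ^ 4 \<Rightarrow> 'a ^ 4 \<Rightarrow> 'a" where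
  "dot u x = (\<Sum>i\<in>UNIV. u $ i * x $ i)"

lemma dot_simps [simp]:
  "dot (u + w) x = dot u x + dot w x" "dot u (x + y) = dot u x + dot u y"
  "dot (u - w) x = dot u x - dot w x" "dot u (x - y) = dot u x - dot u y"
  "dot (t *s u) x = t * dot u x" "dot u (t *s x) = t * dot u x"
  "dot 0 x = 0" "dot u 0 = 0" "dot (- u) x = - dot u x" "dot u (- x) = - dot u x"
  by (simp_all add: dot_def sum.distrib sum_subtractf sum_distrib_left algebra_simps sum_negf)

lemma dot_axis: "dot u (axis i t) = u $ i * t"
  by (simp add: dot_def axis_def if_distrib cong: if_cong)

lemma dot_eqI: "(\<And>x. dot u x = dot w x) \<Longrightarrow> u = w"
  by (metis dot_axis mult.right_neutral vec_eq_iff)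

text \<open>Translation by multiples of \<open>w\<close> permutes the level sets of
  \<open>\<phi>\<close> in \<open>U\<close>, so all of them have the same size. A general
  \<open>U\<close> allows conditions to be imposed one after another.\<close>

lemma card_hyperplane:
  fixes \<phi> :: "'a::{field,finite} ^ 4 \<Rightarrow> 'a"
  assumes lin: "\<And>u t. \<phi> (u + t *s w) = \<phi> u + t" and U: "\<And>u t. u \<in> U \<Longrightarrow> u + t *s w \<in> U"
  shows "card U = CARD('a) * card {u \<in> U. \<phi> u = 0}"
proof -
  have "card {u \<in> U. \<phi> u = t} = card {u \<in> U. \<phi> u = 0}" for t
  proof (rule bij_betw_same_card)
    show "bij_betw (\<lambda>u. u + (-t) *s w) {u \<in> U. \<phi> u = t} {u \<in> U. \<phi> u = 0}"
    proof (rule bij_betw_byWitness[where f' = "\<lambda>u. u + t *s w"])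
      show "(\<lambda>u. u + (-t) *s w) ` {u \<in> U. \<phi> u = t} \<subseteq> {u \<in> U. \<phi> u = 0}"
        using U[of _ "-t"] lin[of _ "-t"] by auto
      show "(\<lambda>u. u + t *s w) ` {u \<in> U. \<phi> u = 0} \<subseteq> {u \<in> U. \<phi> u = t}"
        using U lin by auto
    qed (auto simp: vec.scale_minus_left)
  qed
  hence "(\<Sum>t\<in>UNIV. card {u \<in> U. \<phi> u = t}) = (\<Sum>t\<in>(UNIV::'a set). card {u \<in> U. \<phi> u = 0})"
    by (intro sum.cong refl)
  hence "(\<Sum>t\<in>UNIV. card {u \<in> U. \<phi> u = t}) = CARD('a) * card {u \<in> U. \<phi> u = 0}" by simp
  moreover have "(\<Sum>t\<in>UNIV. card {u \<in> U. \<phi> u = t}) = 1 * card U"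
  proof (rule sum_multicount)
    show "\<forall>j\<in>U. card {i \<in> UNIV. \<phi> j = i} = 1" by simp
  qed auto
  ultimately show ?thesis by simp
qed

text \<open>Stated by coefficients, since independence of the set of the three vectors would not
  notice repetitions.\<close>

definition indep3 :: "'a::{field,finite} ^ 4 \<Rightarrow> 'a ^ 4 \<Rightarrow> 'a ^ 4 \<Rightarrow> bool" where
  "indep3 x y z \<longleftrightarrow> (\<forall>a b c. a *s x + b *s y + c *s z = 0 \<longrightarrow> a = 0 \<and> b = 0 \<and> c = 0)"

lemma indep3D: "indep3 x y z \<Longrightarrow> a *s x + b *s y + c *s z = 0 \<Longrightarrow> a = 0 \<and> b = 0 \<and> c = 0"
  unfolding indep3_def by blast

text \<open>A matrix with three independent rows has a right inverse, and the system is solved by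
  applying it to the prescribed values.\<close>

lemma solve3:
  assumes "indep3 x y z"
  shows "\<exists>u. dot u x = a \<and> dot u y = b \<and> dot u z = c"
proof -
  define A :: "'a ^ 4 ^ 3" where "A = vector [x, y, z]"
  have rows: "row 1 A = x" "row 2 A = y" "row 3 A = z"
    by (simp_all add: A_def row_def vec_eq_iff)
  have "\<exists>B. A ** B = mat 1"
    unfolding matrix_right_invertible_independent_rows
  proof (intro allI impI)
    fix c :: "3 \<Rightarrow> 'a" and i :: 3
    assume "(\<Sum>i\<in>UNIV. c i *s row i A) = 0"
    hence "c 1 *s x + c 2 *s y + c 3 *s z = 0" by (simp add: sum_3 rows)
    hence "c 1 = 0 \<and> c 2 = 0 \<and> c 3 = 0" by (rule indep3D[OF assms])
    thus "c i = 0" using exhaust_3[of i] by auto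
  qed
  then obtain B where B: "A ** B = mat 1" by blast
  define u where "u = B *v vector [a, b, c]"
  have "A *v u = vector [a, b, c]" by (simp add: u_def matrix_vector_mul_assoc B)
  hence e: "(A *v u) $ i = (vector [a, b, c] :: 'a ^ 3) $ i" for i by simp
  have "dot u (A $ i) = (A *v u) $ i" for i
    by (simp add: dot_def matrix_vector_mult_def mult.commute)
  hence "dot u (A $ i) = (vector [a, b, c] :: 'a ^ 3) $ i" for i using e by simp
  from this[of 1] this[of 2] this[of 3] show ?thesis by (auto simp: A_def)
qed

text \<open>The dual vectors provided by \<open>solve3\<close> serve as translations: each changes
  the value at the new vector and preserves the conditions already imposed, so every condition
  divides the count by the field size.\<close>

lemma card_annihilator:
  fixes x y z :: "'a::{field,finite} ^ 4"
  assumes "indep3 x y z"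
  shows "card {u. dot u x = 0} = CARD('a) ^ 3"
    and "card {u. dot u x = 0 \<and> dot u y = 0} = CARD('a) ^ 2"
    and "card {u. dot u x = 0 \<and> dot u y = 0 \<and> dot u z = 0} = CARD('a)"
proof -
  have q: "CARD('a) > 0" by simp
  obtain w1 where w1: "dot w1 x = 1" using solve3[OF assms, of 1 0 0] by blast
  obtain w2 where w2: "dot w2 x = 0" "dot w2 y = 1" using solve3[OF assms, of 0 1 0] by blast
  obtain w3 where w3: "dot w3 x = 0" "dot w3 y = 0" "dot w3 z = 1" using solve3[OF assms, of 0 0 1] by blast
  have "card (UNIV :: ('a ^ 4) set) = CARD('a) * card {u \<in> UNIV. dot u x = 0}"
    by (rule card_hyperplane[where w = w1]) (simp_all add: w1)
  hence "CARD('a) * card {u. dot u x = 0} = CARD('a) * CARD('a) ^ 3"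
    by (simp add: power_numeral_reduce)
  thus 1: "card {u. dot u x = 0} = CARD('a) ^ 3" using q by (simp only: mult_cancel1) simp
  have "card {u. dot u x = 0} = CARD('a) * card {u \<in> {u. dot u x = 0}. dot u y = 0}"
    by (rule card_hyperplane[where w = w2]) (simp_all add: w2)
  hence "CARD('a) * card {u. dot u x = 0 \<and> dot u y = 0} = CARD('a) * CARD('a) ^ 2"
    using 1 by (simp add: power_numeral_reduce)
  thus 2: "card {u. dot u x = 0 \<and> dot u y = 0} = CARD('a) ^ 2" using q by (simp only: mult_cancel1) simp
  have "card {u. dot u x = 0 \<and> dot u y = 0} = CARD('a) * card {u \<in> {u. dot u x = 0 \<and> dot u y = 0}. dot u z = 0}"
    by (rule card_hyperplane[where w = w3]) (simp_all add: w3)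
  hence "CARD('a) * card {u. dot u x = 0 \<and> dot u y = 0 \<and> dot u z = 0} = CARD('a) * CARD('a)"
    using 2 by (simp add: power_numeral_reduce conj_assoc)
  thus "card {u. dot u x = 0 \<and> dot u y = 0 \<and> dot u z = 0} = CARD('a)" using q by (simp only: mult_cancel1) simp
qed

lemma card_hyperplane_vec:
  fixes u :: "'a::{field,finite} ^ 4"
  assumes "u \<noteq> 0"
  shows "card {w. dot u w = 0} = CARD('a) ^ 3"
proof -
  obtain i where i: "u $ i \<noteq> 0" using assms by (auto simp: vec_eq_iff)
  have "card (UNIV :: ('a ^ 4) set) = CARD('a) * card {w \<in> UNIV. dot u w = 0}"
    by (rule card_hyperplane[where w = "axis i (1 / u $ i)"]) (use i in \<open>simp_all add: dot_axis\<close>)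
  hence "CARD('a) * card {w. dot u w = 0} = CARD('a) * CARD('a) ^ 3"
    by (simp add: power_numeral_reduce)
  moreover have "CARD('a) > 0" by simp
  ultimately show ?thesis by (simp only: mult_cancel1) simp
qed

text \<open>The combinations are pairwise different and lie in the kernel of \<open>u\<close>, and
  there are as many of them as vectors in that kernel.\<close>

lemma hyperplane_span3:
  assumes "indep3 x y z" "u \<noteq> 0" "dot u x = 0" "dot u y = 0" "dot u z = 0" "dot u w = 0"
  shows "\<exists>a b c. w = a *s x + b *s y + c *s z"
proof -
  let ?f = "\<lambda>(a, b, c). a *s x + b *s y + c *s z"
  have "a = a' \<and> b = b' \<and> c = c'"
    if "a *s x + b *s y + c *s z = a' *s x + b' *s y + c' *s z" for a b c a' b' c'
  proof -
    have "(a - a') *s x + (b - b') *s y + (c - c') *s z = 0"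
      using that by (simp add: algebra_simps)
    from indep3D[OF assms(1) this] show ?thesis by simp
  qed
  hence "inj ?f" by (intro injI) (simp add: case_prod_unfold prod_eq_iff)
  hence "card (range ?f) = CARD('a \<times> 'a \<times> 'a)" by (rule card_image)
  also have "\<dots> = card {w. dot u w = 0}"
    by (simp add: card_hyperplane_vec[OF assms(2)] power3_eq_cube)
  finally have "range ?f = {w. dot u w = 0}"
    using assms by (intro card_subset_eq) auto
  hence "w \<in> range ?f" using assms(6) by simp
  thus ?thesis by auto
qed

lemma annihilator_proportional:
  fixes u :: "'a::{field,finite} ^ 4"
  assumes "indep3 x y z" "u \<noteq> 0" "dot u x = 0" "dot u y = 0" "dot u z = 0"
    "dot w x = 0" "dot w y = 0" "dot w z = 0"
  shows "\<exists>t. w = t *s u"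
proof -
  have "inj (\<lambda>t. t *s u)" using assms(2) by (auto intro!: injI)
  hence "card (range (\<lambda>t. t *s u)) = CARD('a)" by (rule card_image)
  hence "range (\<lambda>t. t *s u) = {u. dot u x = 0 \<and> dot u y = 0 \<and> dot u z = 0}"
    using assms card_annihilator(3)[OF assms(1)] by (intro card_subset_eq) auto
  thus ?thesis using assms by blast
qed

lemma annihilator_exists:
  fixes x :: "'a::{field,finite} ^ 4"
  assumes "indep3 x y z"
  shows "\<exists>u. u \<noteq> 0 \<and> dot u x = 0 \<and> dot u y = 0 \<and> dot u z = 0"
proof (rule ccontr)
  assume "\<not> ?thesis"
  hence "{u. dot u x = 0 \<and> dot u y = 0 \<and> dot u z = 0} = {0}" by auto
  hence "CARD('a) = 1" using card_annihilator(3)[OF assms] by simp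
  thus False by (metis UNIV_I card_1_singletonE singletonD zero_neq_one)
qed

section \<open>The quadric containing an ovoid\<close>

text \<open>Points stay abstract and carry a representing vector each, so that three points on a
  line become three dependent vectors.\<close>

locale ovoid_vec =
  fixes Q :: "'p set" and v :: "'p \<Rightarrow> ('a::{field,finite}) ^ 4" and q :: nat
  assumes q_eq [simp]: "CARD('a) = q" and odd_q: "odd q" and q_gt3: "q > 3"
    and finQ: "finite Q" and cardQ: "card Q = q^2 + 1"
    and indep: "\<lbrakk>P \<in> Q; R \<in> Q; S \<in> Q; P \<noteq> R; P \<noteq> S; R \<noteq> S\<rbrakk> \<Longrightarrow> indep3 (v P) (v R) (v S)"
begin

lemma odd_card: "odd CARD('a)"
  using odd_q by simp

text \<open>The zero form cuts out all of \<open>Q\<close>, hence the condition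
  \<open>u \<noteq> 0\<close> wherever \<open>sec u\<close> is to be a plane section.\<close>

definition sec :: "'a ^ 4 \<Rightarrow> 'p set" where
  "sec u = {P \<in> Q. dot u (v P) = 0}"

lemma in_sec: "P \<in> sec u \<longleftrightarrow> P \<in> Q \<and> dot u (v P) = 0"
  by (simp add: sec_def)

lemma sec_sub: "sec u \<subseteq> Q"
  by (auto simp: sec_def)

lemma sec_scale: "t \<noteq> 0 \<Longrightarrow> sec (t *s u) = sec u"
  by (auto simp: sec_def)

lemma depend3:
  assumes "P \<in> Q" "R \<in> Q" "S \<in> Q" "P \<noteq> R" "P \<noteq> S" "R \<noteq> S" "a *s v P + b *s v R + c *s v S = 0"
  shows "a = 0 \<and> b = 0 \<and> c = 0"
  using indep3D[OF indep[OF assms(1-6)] assms(7)] .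

lemma q2_gt1: "1 < q^2"
  by (rule one_less_power) (use q_gt3 in auto)

lemma third_point: "\<exists>S\<in>Q. S \<noteq> P \<and> S \<noteq> R"
proof (rule ccontr)
  assume "\<not> ?thesis"
  hence "card Q \<le> card {P, R}" by (intro card_mono) auto
  also have "\<dots> \<le> 2" by (simp add: card_insert_if)
  finally have "q^2 \<le> 1" using cardQ by simp
  thus False using q2_gt1 by simp
qed

lemma pts_basic:
  assumes "P \<in> Q" "R \<in> Q" "P \<noteq> R"
  shows "v P \<noteq> 0" and "v P \<noteq> t *s v R"
proof -
  obtain S where S: "S \<in> Q" "S \<noteq> P" "S \<noteq> R" using third_point by blast
  show "v P \<noteq> 0"
    using depend3[of P R S 1 0 0] assms S by auto
  show "v P \<noteq> t *s v R"
    using depend3[of P R S 1 "-t" 0] assms S by auto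
qed

lemma pt_nonzero: "P \<in> Q \<Longrightarrow> v P \<noteq> 0"
  using pts_basic third_point by blast

text \<open>Coordinates with respect to three points of a plane section: the ratios of two coordinates
  separate the remaining points, because no three points are collinear.\<close>

lemma ratio:
  assumes "P \<in> Q" "R \<in> Q" "T \<in> Q" "P \<noteq> R" "P \<noteq> T" "R \<noteq> T" and W: "W \<subseteq> Q - {P, R, T}"
    and co: "\<And>S. S \<in> W \<Longrightarrow> v S = a S *s v P + b S *s v R + c S *s v T"
  shows "S \<in> W \<Longrightarrow> b S \<noteq> 0" and "S \<in> W \<Longrightarrow> c S \<noteq> 0" and "inj_on (\<lambda>S. b S / c S) W"
proof -
  show b: "b S \<noteq> 0" if "S \<in> W" for S
    using depend3[of P T S "a S" "c S" "-1"] co[OF that] that assms by auto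
  show c: "c S \<noteq> 0" if "S \<in> W" for S
    using depend3[of P R S "a S" "b S" "-1"] co[OF that] that assms by auto
  show "inj_on (\<lambda>S. b S / c S) W"
  proof (rule inj_onI, rule ccontr)
    fix S S' assume *: "S \<in> W" "S' \<in> W" "b S / c S = b S' / c S'" "S \<noteq> S'"
    have e: "c S' * b S = c S * b S'" using *(3) c *(1,2) by (simp add: field_simps)
    have "(c S * a S' - c S' * a S) *s v P + c S' *s v S + (- c S) *s v S' = 0"
    proof -
      have "c S' *s v S - c S *s v S' = (c S' * a S - c S * a S') *s v P + (c S' * b S - c S * b S') *s v R"
        unfolding co[OF *(1)] co[OF *(2)] by (simp add: algebra_simps vec.scale_scale)
      thus ?thesis using e by (simp add: algebra_simps)
    qed
    from depend3[OF _ _ _ _ _ _ this] show False using * c W assms by auto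
  qed
qed

text \<open>At least q - 1 distinct nonzero ratios must be all nonzero field elements, whose product
  is known from Wilson's theorem.\<close>

lemma prod_ratio_full:
  assumes "P \<in> Q" "R \<in> Q" "T \<in> Q" "P \<noteq> R" "P \<noteq> T" "R \<noteq> T" and W: "W \<subseteq> Q - {P, R, T}"
    and co: "\<And>S. S \<in> W \<Longrightarrow> v S = a S *s v P + b S *s v R + c S *s v T"
    and card: "card W \<ge> q - 1"
  shows "card W = q - 1" and "(\<Prod>S\<in>W. b S / c S) = -1"
proof -
  note r = ratio[OF assms(1-6) W co]
  have finW: "finite W" using W finQ finite_subset by blast
  let ?I = "(\<lambda>S. b S / c S) ` W"
  have sub: "?I \<subseteq> UNIV - {0}" using r(1,2) by auto
  have cI: "card ?I = card W" using r(3) by (rule card_image)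
  have cU: "card (UNIV - {0::'a}) = q - 1" by (simp add: card_Diff_subset)
  have "card ?I \<le> q - 1" using sub cU by (metis card_mono finite)
  thus cW: "card W = q - 1" using cI card by simp
  have "?I = UNIV - {0}" using sub cI cU cW by (intro card_subset_eq) auto
  hence "(\<Prod>x\<in>UNIV - {0::'a}. x) = (\<Prod>S\<in>W. b S / c S)"
    using prod.reindex[OF r(3), of "\<lambda>x. x"] by simp
  thus "(\<Prod>S\<in>W. b S / c S) = -1" using wilson[OF odd_card] by simp
qed

text \<open>With q - 2 points exactly one nonzero ratio is missing, and the tangent form at
  \<open>P\<close> identifies it: it belongs to the tangent line at \<open>P\<close>, which contains
  no other point. The known product without that factor gives the equation.\<close>

lemma prod_ratio_tangent:
  assumes "P \<in> Q" "R \<in> Q" "T \<in> Q" "P \<noteq> R" "P \<noteq> T" "R \<noteq> T" and W: "W \<subseteq> Q - {P, R, T}"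
    and co: "\<And>S. S \<in> W \<Longrightarrow> v S = a S *s v P + b S *s v R + c S *s v T"
    and card: "card W = q - 2" and f: "sec f = {P}"
  shows "(\<Prod>S\<in>W. b S / c S) * dot f (v T) = dot f (v R)"
proof -
  note r = ratio[OF assms(1-6) W co]
  have finW: "finite W" using W finQ finite_subset by blast
  have f0: "dot f (v S) = 0 \<longleftrightarrow> S = P" if "S \<in> Q" for S
    using f that unfolding sec_def by auto
  have fR: "dot f (v R) \<noteq> 0" and fT: "dot f (v T) \<noteq> 0" using f0 assms by auto
  \<comment> \<open>The ratio of the last two coordinates at which \<open>f\<close> vanishes, as
    \<open>f\<close> is zero at \<open>v P\<close>.\<close>
  define \<rho> where "\<rho> = - (dot f (v T) / dot f (v R))"
  let ?I = "(\<lambda>S. b S / c S) ` W"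
  have \<rho>0: "\<rho> \<noteq> 0" using fR fT by (simp add: \<rho>_def)
  have \<rho>: "b S / c S \<noteq> \<rho>" if S: "S \<in> W" for S
  proof
    assume "b S / c S = \<rho>"
    hence "b S * dot f (v R) + c S * dot f (v T) = 0"
      using r(2)[of S] S fR by (simp add: \<rho>_def field_simps)
    moreover have "dot f (v S) = a S * dot f (v P) + b S * dot f (v R) + c S * dot f (v T)"
      by (subst co[OF S]) simp
    ultimately have "dot f (v S) = 0" using f0[of P] assms by simp
    thus False using f0[of S] S W by auto
  qed
  have sub: "?I \<subseteq> UNIV - {0, \<rho>}" using r(1,2) \<rho> by auto
  have cI: "card ?I = card W" using r(3) by (rule card_image)
  have cU: "card (UNIV - {0, \<rho>}) = q - 2" using \<rho>0 by (simp add: card_Diff_subset)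
  have "?I = UNIV - {0, \<rho>}" using sub cI cU card by (intro card_subset_eq) auto
  hence "(\<Prod>x\<in>UNIV - {0, \<rho>}. x) = (\<Prod>S\<in>W. b S / c S)"
    using prod.reindex[OF r(3), of "\<lambda>x. x"] by simp
  moreover have "UNIV - {0} = insert \<rho> (UNIV - {0, \<rho>})" using \<rho>0 by auto
  hence "(\<Prod>x\<in>UNIV - {0}. x) = \<rho> * (\<Prod>x\<in>UNIV - {0, \<rho>}. x)" by simp
  ultimately have "\<rho> * (\<Prod>S\<in>W. b S / c S) = -1" using wilson[OF odd_card] by simp
  thus ?thesis using fR by (simp add: \<rho>_def field_simps)
qed

lemma plane_coords:
  assumes "P \<in> Q" "R \<in> Q" "T \<in> Q" "P \<noteq> R" "P \<noteq> T" "R \<noteq> T"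
    and "u \<noteq> 0" "P \<in> sec u" "R \<in> sec u" "T \<in> sec u"
  obtains a b c where "\<And>S. S \<in> sec u \<Longrightarrow> v S = a S *s v P + b S *s v R + c S *s v T"
proof -
  have "\<forall>S\<in>sec u. \<exists>a b c. v S = a *s v P + b *s v R + c *s v T"
    using hyperplane_span3[OF indep[OF assms(1-6)] assms(7)] assms(8-10) by (simp add: in_sec)
  thus ?thesis using that by metis
qed

lemma prod_cycle:
  fixes a b c :: "'b \<Rightarrow> 'c::field"
  assumes "\<And>S. S \<in> W \<Longrightarrow> a S \<noteq> 0 \<and> b S \<noteq> 0 \<and> c S \<noteq> 0"
  shows "(\<Prod>S\<in>W. b S / c S) * (\<Prod>S\<in>W. c S / a S) * (\<Prod>S\<in>W. a S / b S) = 1"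
  using assms by (simp flip: prod.distrib)

text \<open>In a plane section with at least \<open>q + 2\<close> points the three products of coordinate ratios
  would all be \<open>-1\<close> by Wilson's theorem, while their product is \<open>1\<close>.\<close>

lemma sec_card_le:
  assumes u: "u \<noteq> 0"
  shows "card (sec u) \<le> q + 1"
proof (rule ccontr)
  assume big: "\<not> ?thesis"
  hence "3 \<le> card (sec u)" using q_gt3 by simp
  then obtain A where A: "A \<subseteq> sec u" "card A = 3" by (meson obtain_subset_with_card_n)
  then obtain P R T where A3: "A = {P,R,T}" "P \<noteq> R" "R \<noteq> T" "P \<noteq> T" by (auto simp: card_3_iff)
  have S: "P \<in> sec u" "R \<in> sec u" "T \<in> sec u" using A A3 by auto
  have Qs: "P \<in> Q" "R \<in> Q" "T \<in> Q" using S sec_sub by auto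
  obtain a b c where co: "\<And>S. S \<in> sec u \<Longrightarrow> v S = a S *s v P + b S *s v R + c S *s v T"
    using plane_coords[OF Qs _ _ _ u S] A3 by metis
  let ?W = "sec u - {P,R,T}"
  have W: "?W \<subseteq> Q - {P, R, T}" "?W \<subseteq> Q - {R, T, P}" "?W \<subseteq> Q - {T, P, R}" using sec_sub by auto
  have co1: "\<And>S. S \<in> ?W \<Longrightarrow> v S = a S *s v P + b S *s v R + c S *s v T" using co by auto
  \<comment> \<open>Rotating the coordinates cyclically lets the same lemma evaluate the products of
    c / a and a / b.\<close>
  have co2: "\<And>S. S \<in> ?W \<Longrightarrow> v S = b S *s v R + c S *s v T + a S *s v P"
    using co by (simp add: add_ac)
  have co3: "\<And>S. S \<in> ?W \<Longrightarrow> v S = c S *s v T + a S *s v P + b S *s v R"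
    using co by (simp add: add_ac)
  have "card ?W = card (sec u) - 3" using S A3 by (simp add: card_Diff_subset)
  hence cW: "card ?W \<ge> q - 1" using big by simp
  have "(\<Prod>S\<in>?W. b S / c S) = -1"
    by (rule prod_ratio_full(2)[OF Qs _ _ _ W(1) co1 cW]) (use A3 in auto)
  moreover have "(\<Prod>S\<in>?W. c S / a S) = -1"
    by (rule prod_ratio_full(2)[OF Qs(2,3,1) _ _ _ W(2) co2 cW]) (use A3 in auto)
  moreover have "(\<Prod>S\<in>?W. a S / b S) = -1"
    by (rule prod_ratio_full(2)[OF Qs(3,1,2) _ _ _ W(3) co3 cW]) (use A3 in auto)
  moreover have "(\<Prod>S\<in>?W. b S / c S) * (\<Prod>S\<in>?W. c S / a S) * (\<Prod>S\<in>?W. a S / b S) = 1"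
  proof (rule prod_cycle)
    fix S assume "S \<in> ?W"
    thus "a S \<noteq> 0 \<and> b S \<noteq> 0 \<and> c S \<noteq> 0"
      using ratio(1,2)[OF Qs _ _ _ W(1) co1, of S] ratio(2)[OF Qs(2,3,1) _ _ _ W(2) co2, of S] A3 by auto
  qed
  ultimately have "(-1::'a) * (-1) * (-1) = 1" by (simp only:)
  moreover have "(-1::'a) * (-1) * (-1) = -1" by simp
  ultimately have m: "(-1::'a) = 1" by (simp only:)
  have "(2::'a) = 1 - (-1)" by simp
  also have "\<dots> = 0" unfolding m by simp
  finally have "(2::'a) = 0" .
  thus False using two_neq_zero[OF odd_card] by simp
qed

section \<open>Sizes of plane sections and tangent planes\<close>

lemma sum_eq_const:
  fixes h :: "'b \<Rightarrow> nat"
  assumes "finite A" "\<And>x. x \<in> A \<Longrightarrow> h x \<le> m" "sum h A = card A * m" "x \<in> A"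
  shows "h x = m"
proof (rule ccontr)
  assume "h x \<noteq> m"
  hence "sum h A < (\<Sum>x\<in>A. m)"
    using assms by (intro sum_strict_mono_ex1) (auto intro!: bexI[of _ x] simp: le_neq_implies_less)
  thus False using assms by simp
qed

text \<open>The q^2 - 1 nonzero forms vanishing at \<open>P\<close> and \<open>R\<close> have on
  average q - 1 further points in their sections; \<open>sec_card_le\<close> permits no more, so
  every one attains the average.\<close>

lemma sec_card:
  assumes u: "u \<noteq> 0" and PR: "P \<in> sec u" "R \<in> sec u" "P \<noteq> R"
  shows "card (sec u) = q + 1"
proof -
  have Qs: "P \<in> Q" "R \<in> Q" using PR sec_sub by auto
  let ?Z = "\<lambda>w. dot w (v P) = 0 \<and> dot w (v R) = 0"
  let ?U = "{w. ?Z w} - {0}" and ?T = "Q - {P, R}"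
  obtain S0 where S0: "S0 \<in> Q" "S0 \<noteq> P" "S0 \<noteq> R" using third_point by blast
  have cU: "card ?U = q^2 - 1"
    using card_annihilator(2)[OF indep[of P R S0]] Qs S0 PR by (simp add: card_Diff_subset)
  have "(\<Sum>w\<in>?U. card {S \<in> ?T. dot w (v S) = 0}) = (q - 1) * card ?T"
  proof (rule sum_multicount)
    show "\<forall>S\<in>?T. card {w \<in> ?U. dot w (v S) = 0} = q - 1"
    proof
      fix S assume S: "S \<in> ?T"
      have "{w \<in> ?U. dot w (v S) = 0} = {w. dot w (v P) = 0 \<and> dot w (v R) = 0 \<and> dot w (v S) = 0} - {0}"
        by auto
      moreover have "P \<noteq> S" "R \<noteq> S" using S by auto
      ultimately show "card {w \<in> ?U. dot w (v S) = 0} = q - 1"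
        using card_annihilator(3)[OF indep[of P R S]] Qs S PR by (simp add: card_Diff_subset)
    qed
  qed (use finQ in auto)
  moreover have "card ?T = q^2 - 1" using Qs PR cardQ finQ by (simp add: card_Diff_subset)
  ultimately have sum: "(\<Sum>w\<in>?U. card {S \<in> ?T. dot w (v S) = 0}) = card ?U * (q - 1)"
    using cU by (simp add: mult.commute)
  have T: "card {S \<in> ?T. dot w (v S) = 0} = card (sec w) - 2" if "w \<in> ?U" for w
  proof -
    have "{S \<in> ?T. dot w (v S) = 0} = sec w - {P, R}" by (auto simp: sec_def)
    thus ?thesis using that Qs PR by (simp add: card_Diff_subset in_sec)
  qed
  have "u \<in> ?U" using u PR by (simp add: in_sec)
  have "card {S \<in> ?T. dot u (v S) = 0} = q - 1"
  proof (rule sum_eq_const[OF _ _ sum \<open>u \<in> ?U\<close>])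
    fix w assume w: "w \<in> ?U"
    thus "card {S \<in> ?T. dot w (v S) = 0} \<le> q - 1" using T[OF w] sec_card_le[of w] by simp
  qed simp
  hence "card (sec u) - 2 = q - 1" using T[OF \<open>u \<in> ?U\<close>] by simp
  thus ?thesis using q_gt3 by simp
qed

text \<open>Of the q^3 - 1 nonzero forms vanishing at \<open>P\<close>, those with another zero in
  \<open>Q\<close> have q such zeros each, while every other point is a zero of q^2 - 1 forms. Hence
  there are q (q^2 - 1) of them, and the remaining q - 1 forms are the nonzero multiples of a single
  one.\<close>

lemma tangent_plane:
  assumes P: "P \<in> Q"
  shows "\<exists>f. sec f = {P}" and "sec f = {P} \<Longrightarrow> sec u = {P} \<Longrightarrow> \<exists>t. t \<noteq> 0 \<and> u = t *s f"
proof -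
  let ?U = "{w. dot w (v P) = 0} - {0}" and ?T = "Q - {P}"
  let ?N = "{w \<in> ?U. sec w \<noteq> {P}}" and ?G = "{w. sec w = {P}}"
  obtain R0 where R0: "R0 \<in> Q" "R0 \<noteq> P" using third_point by blast
  obtain S0 where S0: "S0 \<in> Q" "S0 \<noteq> P" "S0 \<noteq> R0" using third_point by blast
  have cU: "card ?U = q^3 - 1"
    using card_annihilator(1)[OF indep[of P R0 S0]] P R0 S0 by (simp add: card_Diff_subset)
  have "(\<Sum>w\<in>?U. card {S \<in> ?T. dot w (v S) = 0}) = (q^2 - 1) * card ?T"
  proof (rule sum_multicount)
    show "\<forall>S\<in>?T. card {w \<in> ?U. dot w (v S) = 0} = q^2 - 1"
    proof
      fix S assume S: "S \<in> ?T"
      obtain S1 where S1: "S1 \<in> Q" "S1 \<noteq> P" "S1 \<noteq> S" using third_point by blast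
      have "{w \<in> ?U. dot w (v S) = 0} = {w. dot w (v P) = 0 \<and> dot w (v S) = 0} - {0}" by auto
      moreover have "P \<noteq> S" "P \<noteq> S1" "S \<noteq> S1" using S S1 by auto
      ultimately show "card {w \<in> ?U. dot w (v S) = 0} = q^2 - 1"
        using card_annihilator(2)[OF indep[of P S S1]] P S S1 by (simp add: card_Diff_subset)
    qed
  qed (use finQ in auto)
  moreover have "card ?T = q^2" using P cardQ finQ by (simp add: card_Diff_subset)
  moreover have "(\<Sum>w\<in>?U. card {S \<in> ?T. dot w (v S) = 0}) = (\<Sum>w\<in>?U. if sec w \<noteq> {P} then q else 0)"
  proof (intro sum.cong refl)
    fix w assume w: "w \<in> ?U"
    have Pw: "P \<in> sec w" using w P by (simp add: in_sec)
    have eq: "{S \<in> ?T. dot w (v S) = 0} = sec w - {P}" by (auto simp: sec_def)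
    show "card {S \<in> ?T. dot w (v S) = 0} = (if sec w \<noteq> {P} then q else 0)"
    proof (cases "sec w = {P}")
      case False
      then obtain R where "R \<in> sec w" "R \<noteq> P" using Pw by blast
      hence "card (sec w) = q + 1" using sec_card[of w P R] w Pw by auto
      thus ?thesis using eq False Pw by (simp add: card_Diff_subset)
    next
      case True
      thus ?thesis unfolding eq by simp
    qed
  qed
  moreover have "(\<Sum>w\<in>?U. if sec w \<noteq> {P} then q else 0) = q * card ?N"
    by (simp add: sum.If_cases Int_def conj_commute)
  ultimately have "q * card ?N = (q^2 - 1) * q^2" by (simp only:)
  also have "\<dots> = q * (q * (q^2 - 1))" by (simp only: power2_eq_square mult_ac)
  finally have "q * card ?N = q * (q * (q^2 - 1))" .
  hence cN: "card ?N = q * (q^2 - 1)" using q_gt3 by (simp only: mult_cancel1) auto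
  have G: "w \<noteq> 0 \<and> dot w (v P) = 0" if "sec w = {P}" for w
  proof -
    have "sec 0 = Q" by (simp add: sec_def)
    hence "w \<noteq> 0" using that R0 by auto
    moreover have "P \<in> sec w" using that by simp
    ultimately show ?thesis by (simp add: in_sec)
  qed
  have "?U = ?N \<union> ?G" using G by auto
  hence "card ?U = card (?N \<union> ?G)" by (rule arg_cong)
  also have "\<dots> = card ?N + card ?G" by (intro card_Un_disjoint) auto
  finally have "q^3 - 1 = q * (q^2 - 1) + card ?G" unfolding cU cN .
  moreover have "q^3 - 1 = q * (q^2 - 1) + (q - 1)"
  proof -
    have "q \<le> q^3" by (rule self_le_power) (use q_gt3 in auto)
    thus ?thesis using q_gt3 by (simp add: right_diff_distrib' power_numeral_reduce)
  qed
  ultimately have cG: "card ?G = q - 1" by linarith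
  hence "card ?G \<noteq> 0" using q_gt3 by simp
  hence "?G \<noteq> {}" by (intro notI) (simp only: card.empty)
  thus "\<exists>f. sec f = {P}" by blast
  show "\<exists>t. t \<noteq> 0 \<and> u = t *s f" if f: "sec f = {P}" and u: "sec u = {P}"
  proof -
    have "inj_on (\<lambda>t. t *s f) (UNIV - {0})" using G[OF f] by (auto intro!: inj_onI)
    hence "card ((\<lambda>t. t *s f) ` (UNIV - {0})) = q - 1"
      by (simp add: card_image card_Diff_subset)
    hence "(\<lambda>t. t *s f) ` (UNIV - {0}) = ?G"
      using cG f sec_scale by (intro card_subset_eq) auto
    thus ?thesis using u by blast
  qed
qed

text \<open>Segre's lemma of tangents: each tangent form turns one product of coordinate ratios into
  a quotient of its values, and the three products multiply to 1.\<close>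

lemma segre_tangents:
  assumes Qs: "P \<in> Q" "R \<in> Q" "T \<in> Q" and ne: "P \<noteq> R" "P \<noteq> T" "R \<noteq> T"
    and f: "sec f = {P}" and g: "sec g = {R}" and h: "sec h = {T}"
  shows "dot f (v R) * dot g (v T) * dot h (v P) = dot f (v T) * dot g (v P) * dot h (v R)"
proof -
  obtain u where u: "u \<noteq> 0" "dot u (v P) = 0" "dot u (v R) = 0" "dot u (v T) = 0"
    using annihilator_exists[OF indep[OF Qs ne]] by blast
  have S: "P \<in> sec u" "R \<in> sec u" "T \<in> sec u" using u Qs by (auto simp: in_sec)
  obtain a b c where co: "\<And>S. S \<in> sec u \<Longrightarrow> v S = a S *s v P + b S *s v R + c S *s v T"
    using plane_coords[OF Qs ne u(1) S] by metis
  let ?W = "sec u - {P,R,T}"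
  have W: "?W \<subseteq> Q - {P, R, T}" "?W \<subseteq> Q - {R, T, P}" "?W \<subseteq> Q - {T, P, R}" using sec_sub by auto
  have co1: "\<And>S. S \<in> ?W \<Longrightarrow> v S = a S *s v P + b S *s v R + c S *s v T" using co by auto
  have co2: "\<And>S. S \<in> ?W \<Longrightarrow> v S = b S *s v R + c S *s v T + a S *s v P"
    using co by (simp add: add_ac)
  have co3: "\<And>S. S \<in> ?W \<Longrightarrow> v S = c S *s v T + a S *s v P + b S *s v R"
    using co by (simp add: add_ac)
  have cW: "card ?W = q - 2"
    using S ne sec_card[OF u(1) S(1,2) ne(1)] by (simp add: card_Diff_subset)
  define A B C where "A = (\<Prod>S\<in>?W. b S / c S)" and "B = (\<Prod>S\<in>?W. c S / a S)"
    and "C = (\<Prod>S\<in>?W. a S / b S)"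
  have 1: "A * dot f (v T) = dot f (v R)" unfolding A_def
    by (rule prod_ratio_tangent[OF Qs ne W(1) co1 cW f])
  have 2: "B * dot g (v P) = dot g (v T)" unfolding B_def
    by (rule prod_ratio_tangent[OF Qs(2,3,1) _ _ _ W(2) co2 cW g]) (use ne in auto)
  have 3: "C * dot h (v R) = dot h (v P)" unfolding C_def
    by (rule prod_ratio_tangent[OF Qs(3,1,2) _ _ _ W(3) co3 cW h]) (use ne in auto)
  have ABC: "A * B * C = 1" unfolding A_def B_def C_def
  proof (rule prod_cycle)
    fix S assume "S \<in> ?W"
    thus "a S \<noteq> 0 \<and> b S \<noteq> 0 \<and> c S \<noteq> 0"
      using ratio(1,2)[OF Qs ne W(1) co1, of S] ratio(2)[OF Qs(2,3,1) _ _ _ W(2) co2, of S] ne by auto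
  qed
  have "dot f (v R) * dot g (v T) * dot h (v P) = (A * B * C) * (dot f (v T) * dot g (v P) * dot h (v R))"
    unfolding 1[symmetric] 2[symmetric] 3[symmetric] by (simp add: mult_ac)
  thus ?thesis using ABC by simp
qed

text \<open>All tangent forms are scaled against one base point \<open>O'\<close> so that symmetry
  holds for pairs containing \<open>O'\<close>. The lemma of tangents for \<open>O'\<close>,
  \<open>P\<close> and \<open>R\<close> then carries it over to all other pairs.\<close>

lemma symmetric_tangents:
  "\<exists>g. \<forall>P\<in>Q. sec (g P) = {P} \<and> (\<forall>R\<in>Q. dot (g P) (v R) = dot (g R) (v P))"
proof -
  obtain f where f: "\<And>P. P \<in> Q \<Longrightarrow> sec (f P) = {P}" using tangent_plane(1) by metis
  have f0: "dot (f P) (v R) = 0 \<longleftrightarrow> R = P" if "P \<in> Q" "R \<in> Q" for P R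
    using f[OF that(1)] that(2) unfolding sec_def by auto
  obtain O' where O': "O' \<in> Q" using third_point by blast
  define l where "l P = (if P = O' then 1 else dot (f O') (v P) / dot (f P) (v O'))" for P
  define g where "g P = l P *s f P" for P
  have l0: "l P \<noteq> 0" if "P \<in> Q" for P using f0 that O' by (simp add: l_def)
  have sg: "sec (g P) = {P}" if "P \<in> Q" for P
    using f[OF that] l0[OF that] by (simp add: g_def sec_scale)
  have g0: "dot (g P) (v R) = 0 \<longleftrightarrow> R = P" if "P \<in> Q" "R \<in> Q" for P R
    using sg[OF that(1)] that(2) unfolding sec_def by auto
  have gO: "dot (g P) (v O') = dot (g O') (v P)" if "P \<in> Q" for P
    using f0[OF that O'] by (simp add: g_def l_def)
  have "dot (g P) (v R) = dot (g R) (v P)" if PR: "P \<in> Q" "R \<in> Q" for P R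
  proof -
    consider "P = R" | "P = O'" | "R = O'" | "P \<noteq> R" "O' \<noteq> P" "O' \<noteq> R" by blast
    thus ?thesis
    proof cases
      case 4
      have "dot (g O') (v P) * dot (g P) (v R) * dot (g R) (v O')
          = dot (g O') (v R) * dot (g P) (v O') * dot (g R) (v P)"
        by (rule segre_tangents[OF O' PR _ _ _ sg[OF O'] sg[OF PR(1)] sg[OF PR(2)]]) (use 4 in auto)
      moreover have "dot (g O') (v P) \<noteq> 0" "dot (g O') (v R) \<noteq> 0" using g0[OF O'] PR 4 by auto
      ultimately show ?thesis using gO PR by (simp add: mult.commute)
    qed (use gO PR in auto)
  qed
  thus ?thesis using sg by blast
qed

text \<open>A plane holds at most q + 1 points of \<open>Q\<close>, so a fourth point exists off the
  plane of three; \<open>d\<close> is the dual basis.\<close>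

lemma point_basis:
  "\<exists>(b :: 4 \<Rightarrow> 'p) d. (\<forall>i. b i \<in> Q) \<and> (\<forall>w. w = (\<Sum>i\<in>UNIV. dot (d i) w *s v (b i)))"
proof -
  obtain P where P: "P \<in> Q" using third_point by blast
  obtain R where R: "R \<in> Q" "R \<noteq> P" using third_point by blast
  obtain T where T: "T \<in> Q" "T \<noteq> P" "T \<noteq> R" using third_point by blast
  have ind: "indep3 (v P) (v R) (v T)" by (rule indep) (use P R T in auto)
  obtain u where u: "u \<noteq> 0" "dot u (v P) = 0" "dot u (v R) = 0" "dot u (v T) = 0"
    using annihilator_exists[OF ind] by blast
  have "card (sec u) < card Q"
  proof -
    have "q < q * q" using q_gt3 by simp
    thus ?thesis using sec_card_le[OF u(1)] cardQ unfolding power2_eq_square by linarith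
  qed
  hence "sec u \<noteq> Q" by auto
  then obtain S where S: "S \<in> Q" "dot u (v S) \<noteq> 0" by (auto simp: sec_def)
  define d4 where "d4 = (1 / dot u (v S)) *s u"
  have d4: "dot d4 (v P) = 0" "dot d4 (v R) = 0" "dot d4 (v T) = 0" "dot d4 (v S) = 1" "d4 \<noteq> 0"
    using u S by (auto simp: d4_def)
  obtain w1 where w1: "dot w1 (v P) = 1" "dot w1 (v R) = 0" "dot w1 (v T) = 0"
    using solve3[OF ind, of 1 0 0] by blast
  obtain w2 where w2: "dot w2 (v P) = 0" "dot w2 (v R) = 1" "dot w2 (v T) = 0"
    using solve3[OF ind, of 0 1 0] by blast
  obtain w3 where w3: "dot w3 (v P) = 0" "dot w3 (v R) = 0" "dot w3 (v T) = 1"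
    using solve3[OF ind, of 0 0 1] by blast
  \<comment> \<open>Subtracting a multiple of \<open>d4\<close> makes the form vanish at
    \<open>S\<close> and keeps its values at the first three points.\<close>
  define d where "d i = (if i = 1 then w1 - dot w1 (v S) *s d4 else if i = 2 then w2 - dot w2 (v S) *s d4
    else if i = 3 then w3 - dot w3 (v S) *s d4 else d4)" for i :: 4
  define b where "b i = (if i = 1 then P else if i = 2 then R else if i = 3 then T else S)" for i :: 4
  have d: "d 1 = w1 - dot w1 (v S) *s d4" "d 2 = w2 - dot w2 (v S) *s d4" "d 3 = w3 - dot w3 (v S) *s d4"
      "d 4 = d4" and b: "b 1 = P" "b 2 = R" "b 3 = T" "b 4 = S"
    by (simp_all add: d_def b_def)
  have dual: "dot (d 1) (v P) = 1" "dot (d 1) (v R) = 0" "dot (d 1) (v T) = 0" "dot (d 1) (v S) = 0"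
    "dot (d 2) (v P) = 0" "dot (d 2) (v R) = 1" "dot (d 2) (v T) = 0" "dot (d 2) (v S) = 0"
    "dot (d 3) (v P) = 0" "dot (d 3) (v R) = 0" "dot (d 3) (v T) = 1" "dot (d 3) (v S) = 0"
    "dot (d 4) (v P) = 0" "dot (d 4) (v R) = 0" "dot (d 4) (v T) = 0" "dot (d 4) (v S) = 1"
    unfolding d using d4 w1 w2 w3 by simp_all
  have "w = (\<Sum>i\<in>UNIV. dot (d i) w *s v (b i))" for w
  proof -
    define z where "z = w - (\<Sum>i\<in>UNIV. dot (d i) w *s v (b i))"
    have zz: "z = w - (dot (d 1) w *s v P + dot (d 2) w *s v R + dot (d 3) w *s v T + dot (d 4) w *s v S)"
      unfolding z_def sum_4 b by (simp add: add_ac)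
    have 0: "dot (d 1) z = 0" "dot (d 2) z = 0" "dot (d 3) z = 0" "dot (d 4) z = 0"
      unfolding zz by (simp_all add: dual)
    have "dot d4 z = 0" using 0(4) by (simp only: d)
    then obtain a1 a2 a3 where z: "z = a1 *s v P + a2 *s v R + a3 *s v T"
      using hyperplane_span3[OF ind d4(5,1,2,3)] by blast
    have "a1 = 0" using 0(1) unfolding z by (simp add: dual)
    moreover have "a2 = 0" using 0(2) unfolding z by (simp add: dual)
    moreover have "a3 = 0" using 0(3) unfolding z by (simp add: dual)
    ultimately have "z = 0" using z by simp
    thus ?thesis by (simp only: z_def right_minus_eq)
  qed
  moreover have "b i \<in> Q" for i using P R T S by (simp add: b_def)
  ultimately show ?thesis by blast
qed

text \<open>The polarity of the quadric that contains the ovoid.\<close>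

lemma polarity_exists:
  "\<exists>L :: 'a ^ 4 \<Rightarrow> 'a ^ 4. (\<forall>x y. L (x + y) = L x + L y) \<and> (\<forall>t x. L (t *s x) = t *s L x)
    \<and> (\<forall>x y. dot (L x) y = dot (L y) x) \<and> (\<forall>P\<in>Q. sec (L (v P)) = {P})"
proof -
  obtain g where g: "\<And>P. P \<in> Q \<Longrightarrow> sec (g P) = {P}"
    and gs: "\<And>P R. P \<in> Q \<Longrightarrow> R \<in> Q \<Longrightarrow> dot (g P) (v R) = dot (g R) (v P)"
    using symmetric_tangents by metis
  obtain b d where b': "\<forall>i. b i \<in> Q" and bd': "\<forall>w. w = (\<Sum>i\<in>(UNIV::4 set). dot (d i) w *s v (b i))"
    using point_basis by (elim exE conjE)
  note b = b'[rule_format] and bd = bd'[rule_format]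
  \<comment> \<open>The tangent forms are extended linearly from the four basis points.\<close>
  define L where "L w = (\<Sum>i\<in>UNIV. dot (d i) w *s g (b i))" for w
  have dot_sum: "dot (sum h A) x = (\<Sum>i\<in>A. dot (h i) x)" "dot x (sum h A) = (\<Sum>i\<in>A. dot x (h i))"
    for h :: "4 \<Rightarrow> 'a ^ 4" and A x
    by (induction A rule: infinite_finite_induct) simp_all
  have add: "L (x + y) = L x + L y" for x y
    by (simp add: L_def sum.distrib vec.scale_left_distrib)
  have scale: "L (t *s x) = t *s L x" for t x
    by (simp add: L_def vec.scale_sum_right vec.scale_scale)
  have L1: "dot (L x) y = (\<Sum>i\<in>UNIV. \<Sum>j\<in>UNIV. dot (d i) x * (dot (d j) y * dot (g (b i)) (v (b j))))" for x y
  proof -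
    have "dot (L x) y = (\<Sum>i\<in>UNIV. dot (d i) x * dot (g (b i)) y)" by (simp add: L_def dot_sum)
    also have "\<dots> = (\<Sum>i\<in>UNIV. dot (d i) x * dot (g (b i)) (\<Sum>j\<in>UNIV. dot (d j) y *s v (b j)))"
      by (simp only: bd[symmetric])
    finally show ?thesis by (simp add: dot_sum sum_distrib_left)
  qed
  have sym: "dot (L x) y = dot (L y) x" for x y
  proof -
    have "dot (L x) y = (\<Sum>j\<in>UNIV. \<Sum>i\<in>UNIV. dot (d i) x * (dot (d j) y * dot (g (b i)) (v (b j))))"
      unfolding L1 by (rule sum.swap)
    also have "\<dots> = dot (L y) x"
      unfolding L1 by (intro sum.cong refl) (simp add: gs[OF b b] mult_ac)
    finally show ?thesis .
  qed
  have "L (v P) = g P" if P: "P \<in> Q" for P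
  proof (rule dot_eqI)
    fix x
    \<comment> \<open>By symmetry both forms take at \<open>v (b j)\<close> the value of
      \<open>g (b j)\<close> at \<open>v P\<close>, and agreement on a basis suffices.\<close>
    have j: "dot (L (v P)) (v (b j)) = dot (g P) (v (b j))" for j
    proof -
      have "dot (L (v P)) (v (b j)) = (\<Sum>i\<in>UNIV. dot (d i) (v P) * dot (g (b i)) (v (b j)))"
        by (simp add: L_def dot_sum)
      also have "\<dots> = (\<Sum>i\<in>UNIV. dot (d i) (v P) * dot (g (b j)) (v (b i)))"
        by (intro sum.cong refl) (simp add: gs[OF b b])
      also have "\<dots> = dot (g (b j)) (\<Sum>i\<in>UNIV. dot (d i) (v P) *s v (b i))" by (simp add: dot_sum)
      also have "\<dots> = dot (g (b j)) (v P)" by (simp only: bd[symmetric])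
      also have "\<dots> = dot (g P) (v (b j))" by (rule gs[OF b P])
      finally show ?thesis .
    qed
    have "dot (L (v P)) (\<Sum>j\<in>UNIV. dot (d j) x *s v (b j)) = dot (g P) (\<Sum>j\<in>UNIV. dot (d j) x *s v (b j))"
      by (simp add: dot_sum j)
    thus "dot (L (v P)) x = dot (g P) x" by (simp only: bd[symmetric])
  qed
  thus ?thesis using add scale sym g by (intro exI[of _ L]) auto
qed

text \<open>By \<open>sec_card\<close> the cardinality condition only discards sections with fewer
  than two points, such as those by tangent planes.\<close>

definition circles :: "'p set set" where
  "circles = {sec u | u. u \<noteq> 0 \<and> card (sec u) = q + 1}"

lemma circlesI: "u \<noteq> 0 \<Longrightarrow> card (sec u) = q + 1 \<Longrightarrow> sec u \<in> circles"
  unfolding circles_def by blast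

lemma circle_through:
  assumes "P \<in> Q" "R \<in> Q" "S \<in> Q" "P \<noteq> R" "P \<noteq> S" "R \<noteq> S"
  shows "\<exists>!C. C \<in> circles \<and> P \<in> C \<and> R \<in> C \<and> S \<in> C"
proof -
  note ind = indep[OF assms]
  obtain u where u: "u \<noteq> 0" "dot u (v P) = 0" "dot u (v R) = 0" "dot u (v S) = 0"
    using annihilator_exists[OF ind] by blast
  have us: "P \<in> sec u" "R \<in> sec u" "S \<in> sec u" using u assms by (auto simp: in_sec)
  show ?thesis
  proof (rule ex1I[of _ "sec u"])
    show "sec u \<in> circles \<and> P \<in> sec u \<and> R \<in> sec u \<and> S \<in> sec u"
      using circlesI[OF u(1) sec_card[OF u(1) us(1,2) assms(4)]] us by blast
  next
    fix D assume "D \<in> circles \<and> P \<in> D \<and> R \<in> D \<and> S \<in> D"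
    then obtain w where w: "w \<noteq> 0" "D = sec w" "P \<in> sec w" "R \<in> sec w" "S \<in> sec w"
      by (auto simp: circles_def)
    hence "\<exists>t. w = t *s u"
      using annihilator_proportional[OF ind u(1-4), of w] by (simp add: in_sec)
    then obtain t where "w = t *s u" ..
    thus "D = sec u" using w(1,2) sec_scale[of t u] by auto
  qed
qed

sublocale inv: inversive_plane Q circles q
proof
  show "C \<subseteq> Q" if "C \<in> circles" for C using that sec_sub by (auto simp: circles_def)
  show "card C = q + 1" if "C \<in> circles" for C using that by (auto simp: circles_def)
qed (use q_gt3 finQ cardQ circle_through in simp_all)

section \<open>The symmetric bilinear form of the quadric and its isotropic vectors\<close>

definition L :: "'a ^ 4 \<Rightarrow> 'a ^ 4" where
  "L = (SOME L. (\<forall>x y. L (x + y) = L x + L y) \<and> (\<forall>t x. L (t *s x) = t *s L x)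
    \<and> (\<forall>x y. dot (L x) y = dot (L y) x) \<and> (\<forall>P\<in>Q. sec (L (v P)) = {P}))"

definition B :: "'a ^ 4 \<Rightarrow> 'a ^ 4 \<Rightarrow> 'a" where
  "B x y = dot (L x) y"

lemma L_props: "L (x + y) = L x + L y" "L (t *s x) = t *s L x" "dot (L x) y = dot (L y) x"
  "P \<in> Q \<Longrightarrow> sec (L (v P)) = {P}"
  using someI_ex[OF polarity_exists] unfolding L_def[symmetric] by blast+

lemma L_zero: "L 0 = 0" and L_minus: "L (- x) = - L x" and L_diff: "L (x - y) = L x - L y"
proof -
  show "L 0 = 0" using L_props(2)[of 0 0] by simp
  show m: "L (- x) = - L x" for x using L_props(2)[of "-1" x] by simp
  show "L (x - y) = L x - L y" using L_props(1)[of x "- y"] m by simp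
qed

lemma B_commute: "B x y = B y x"
  unfolding B_def by (rule L_props(3))

lemma B_simps [simp]:
  "B (x + y) z = B x z + B y z" "B z (x + y) = B z x + B z y"
  "B (t *s x) z = t * B x z" "B z (t *s x) = t * B z x"
  "B (x - y) z = B x z - B y z" "B z (x - y) = B z x - B z y"
  "B (- x) z = - B x z" "B z (- x) = - B z x" "B 0 z = 0" "B z 0 = 0"
  by (simp_all add: B_def L_props(1,2) L_zero L_minus L_diff)

lemma in_sec_L: "P \<in> sec (L c) \<longleftrightarrow> P \<in> Q \<and> B c (v P) = 0"
  by (simp add: in_sec B_def)

lemma B_points: "P \<in> Q \<Longrightarrow> R \<in> Q \<Longrightarrow> B (v P) (v R) = 0 \<longleftrightarrow> R = P"
  using L_props(4)[of P] in_sec_L[of R "v P"] by auto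

lemma point_isotropic [simp]: "P \<in> Q \<Longrightarrow> B (v P) (v P) = 0"
  using B_points by simp

lemma two_nz: "(2::'a) \<noteq> 0"
  by (rule two_neq_zero[OF odd_card])

text \<open>On the plane spanned by \<open>v P\<close>, \<open>v R\<close> and \<open>z\<close> the
  quadratic form is 2 a b B (v P) (v R) in coordinates a, b, c. A point of \<open>Q\<close> there
  has a = 0 or b = 0, is therefore orthogonal to \<open>P\<close> or \<open>R\<close> and equals one
  of them, whereas the plane should contain q + 1 points.\<close>

lemma isotropic_no_secant:
  assumes z: "z \<noteq> 0" "B z z = 0" and PR: "P \<in> Q" "R \<in> Q" "P \<noteq> R"
    and "B z (v P) = 0" "B z (v R) = 0"
  shows False
proof -
  have Bz: "B (v P) z = 0" "B (v R) z = 0" using assms B_commute by metis+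
  have BPR: "B (v P) (v R) \<noteq> 0" "B (v R) (v P) \<noteq> 0" using B_points PR by auto
  have ind: "indep3 (v P) (v R) z"
    unfolding indep3_def
  proof (intro allI impI)
    fix a b c assume e: "a *s v P + b *s v R + c *s z = 0"
    have "B (v P) (a *s v P + b *s v R + c *s z) = 0" unfolding e by simp
    hence b: "b = 0" using PR Bz BPR by simp
    have "B (v R) (a *s v P + b *s v R + c *s z) = 0" unfolding e by simp
    hence "a = 0" using PR Bz BPR by simp
    thus "a = 0 \<and> b = 0 \<and> c = 0" using e b z by simp
  qed
  obtain u where u: "u \<noteq> 0" "dot u (v P) = 0" "dot u (v R) = 0" "dot u z = 0"
    using annihilator_exists[OF ind] by blast
  have us: "P \<in> sec u" "R \<in> sec u" using u PR by (auto simp: in_sec)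
  have "sec u \<subseteq> {P, R}"
  proof
    fix S assume "S \<in> sec u"
    hence S: "S \<in> Q" "dot u (v S) = 0" by (simp_all add: in_sec)
    obtain a b c where w: "v S = a *s v P + b *s v R + c *s z"
      using hyperplane_span3[OF ind u S(2)] by blast
    have "B (v S) (v S) = 2 * (a * b) * B (v P) (v R)"
      unfolding w using PR z assms(6,7) Bz B_commute[of "v R" "v P"] by (simp add: algebra_simps)
    hence "a = 0 \<or> b = 0" using S(1) BPR two_nz by simp
    moreover have "B (v S) (v P) = b * B (v R) (v P)" "B (v S) (v R) = a * B (v P) (v R)"
      unfolding w using PR assms(6,7) by simp_all
    ultimately have "B (v S) (v P) = 0 \<or> B (v S) (v R) = 0" by auto
    thus "S \<in> {P, R}" using B_points S(1) PR by auto
  qed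
  hence "card (sec u) \<le> card {P, R}" by (intro card_mono) auto
  also have "\<dots> = 2" using PR by simp
  finally show False using sec_card[OF u(1) us PR(3)] q_gt3 by simp
qed

lemma two_points: "\<exists>P\<in>Q. \<exists>R\<in>Q. P \<noteq> R"
  using third_point by metis

text \<open>A nonzero vector orthogonal to everything would be isotropic and orthogonal to two
  points of \<open>Q\<close>.\<close>

lemma L_inj: "L x = L y \<Longrightarrow> x = y"
proof (rule ccontr)
  assume e: "L x = L y" "x \<noteq> y"
  hence "B (x - y) w = 0" for w by (simp add: B_def L_diff)
  moreover obtain P R where "P \<in> Q" "R \<in> Q" "P \<noteq> R" using two_points by blast
  ultimately show False using isotropic_no_secant[of "x - y" P R] e by auto
qed

lemma L_surj: "\<exists>c. u = L c"
  using finite_UNIV_inj_surj[of L] L_inj by (auto simp: inj_def surj_def)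

lemma L_eq_0_iff: "L c = 0 \<longleftrightarrow> c = 0"
  using L_inj[of c 0] L_zero by auto

text \<open>So \<open>Q\<close> is the whole quadric. For an isotropic \<open>z\<close> off
  \<open>Q\<close>, choose a point \<open>X\<close> not orthogonal to it and count the points on the
  planes through \<open>z\<close> and \<open>X\<close>: each of the q^2 other points is a zero of q
  - 1 of the q^2 - 1 forms, yet each form has q of them as zeros, and (q^2 - 1) q differs from (q -
  1) q^2.\<close>

lemma isotropic_point:
  assumes z: "z \<noteq> 0" "B z z = 0"
  shows "\<exists>P\<in>Q. \<exists>t. t \<noteq> 0 \<and> z = t *s v P"
proof (rule ccontr)
  assume no: "\<not> ?thesis"
  obtain O1 O2 where "O1 \<in> Q" "O2 \<in> Q" "O1 \<noteq> O2" using two_points by blast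
  then obtain X where X: "X \<in> Q" "B z (v X) \<noteq> 0" using isotropic_no_secant[OF z, of O1 O2] by blast
  have BX: "B (v X) z \<noteq> 0" using X(2) B_commute by metis
  have zno: "z \<noteq> t *s v Y" if "Y \<in> Q" for Y t
    using no that z(1) by (cases "t = 0") auto
  let ?U = "{u. dot u z = 0 \<and> dot u (v X) = 0} - {0}" and ?T = "Q - {X}"
  have ind: "indep3 z (v X) (v Y)" if Y: "Y \<in> ?T" for Y
    unfolding indep3_def
  proof (intro allI impI)
    fix a b c assume e: "a *s z + b *s v X + c *s v Y = 0"
    \<comment> \<open>On the line joining \<open>z\<close> and \<open>X\<close> only these two
      points are isotropic, so \<open>Y\<close> cannot lie on it.\<close>
    have c: "c = 0"
    proof (rule ccontr)
      assume c: "c \<noteq> 0"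
      have "c *s v Y = - (a *s z + b *s v X)" using e by (simp only: add_eq_0_iff)
      hence "B (c *s v Y) (c *s v Y) = B (a *s z + b *s v X) (a *s z + b *s v X)"
        by (simp only: B_simps(7,8) minus_minus)
      also have "\<dots> = 2 * (a * b) * B z (v X)"
        using z X(1) B_commute[of "v X" z] by (simp add: algebra_simps)
      finally have "2 * (a * b) * B z (v X) = 0" using Y by simp
      hence "a = 0 \<or> b = 0" using X two_nz by simp
      thus False
      proof
        assume "a = 0"
        hence "b *s v X + c *s v Y = 0" using e by simp
        hence "B (v X) (b *s v X + c *s v Y) = 0" by simp
        thus False using c X Y B_points[of X Y] by simp
      next
        assume b: "b = 0"
        hence e': "a *s z + c *s v Y = 0" using e by simp
        hence a: "a \<noteq> 0" using c Y pt_nonzero[of Y] by auto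
        have "(1 / a) *s (a *s z + c *s v Y) = 0" unfolding e' by simp
        hence "z + (c / a) *s v Y = 0" using a by (simp add: vec.scale_right_distrib vec.scale_scale)
        hence "z = (- (c / a)) *s v Y" by (simp add: eq_neg_iff_add_eq_0)
        thus False using zno Y by blast
      qed
    qed
    have "a = 0"
    proof (rule ccontr)
      assume a: "a \<noteq> 0"
      have e': "a *s z + b *s v X = 0" using e c by simp
      have "(1 / a) *s (a *s z + b *s v X) = 0" unfolding e' by simp
      hence "z + (b / a) *s v X = 0" using a by (simp add: vec.scale_right_distrib vec.scale_scale)
      hence "z = (- (b / a)) *s v X" by (simp add: eq_neg_iff_add_eq_0)
      thus False using zno X by blast
    qed
    thus "a = 0 \<and> b = 0 \<and> c = 0" using e c pt_nonzero[OF X(1)] by simp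
  qed
  obtain Y0 where Y0: "Y0 \<in> ?T" using third_point by blast
  have cU: "card ?U = q^2 - 1" using card_annihilator(2)[OF ind[OF Y0]] by (simp add: card_Diff_subset)
  have "(\<Sum>w\<in>?U. card {S \<in> ?T. dot w (v S) = 0}) = (q - 1) * card ?T"
  proof (rule sum_multicount)
    show "\<forall>S\<in>?T. card {w \<in> ?U. dot w (v S) = 0} = q - 1"
    proof
      fix S assume S: "S \<in> ?T"
      have "{w \<in> ?U. dot w (v S) = 0} = {w. dot w z = 0 \<and> dot w (v X) = 0 \<and> dot w (v S) = 0} - {0}"
        by auto
      thus "card {w \<in> ?U. dot w (v S) = 0} = q - 1"
        using card_annihilator(3)[OF ind[OF S]] by (simp add: card_Diff_subset)
    qed
  qed (use finQ in auto)
  moreover have "card {S \<in> ?T. dot w (v S) = 0} = q" if w: "w \<in> ?U" for w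
  proof -
    have w0: "w \<noteq> 0" "X \<in> sec w" "dot w z = 0" using w X by (simp_all add: in_sec)
    \<comment> \<open>The tangent form at \<open>X\<close> does not vanish at \<open>z\<close>, by
      the choice of \<open>X\<close>.\<close>
    have "sec w \<noteq> {X}"
    proof
      assume "sec w = {X}"
      then obtain t where "t \<noteq> 0" "w = t *s L (v X)"
        using tangent_plane(2)[OF X(1) L_props(4)[OF X(1)]] by blast
      thus False using w0(3) BX by (simp add: B_def)
    qed
    then obtain Y where "Y \<in> sec w" "X \<noteq> Y" using w0(2) by blast
    hence "card (sec w) = q + 1" using sec_card[OF w0(1,2)] by blast
    moreover have "{S \<in> ?T. dot w (v S) = 0} = sec w - {X}" by (auto simp: sec_def)
    ultimately show ?thesis using w0(2) by (simp add: card_Diff_subset)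
  qed
  moreover have "card ?T = q^2" using X cardQ finQ by (simp add: card_Diff_subset)
  ultimately have "(q^2 - 1) * q = (q - 1) * q^2" using cU by simp
  moreover have "(q^2 - 1) = (q - 1) * (q + 1)" by (cases q) (simp_all add: power2_eq_square)
  ultimately have "((q - 1) * q) * (q + 1) = ((q - 1) * q) * q"
    by (simp only: power2_eq_square mult_ac)
  hence "q + 1 = q" using q_gt3 by (simp only: mult_cancel1) auto
  thus False by simp
qed

section \<open>Poles, norms and tangency of circles\<close>

lemma circle_pole:
  assumes "C \<in> circles"
  obtains c where "C = sec (L c)" "c \<noteq> 0"
proof -
  obtain u where u: "C = sec u" "u \<noteq> 0" using assms by (auto simp: circles_def)
  moreover obtain c where "u = L c" using L_surj by blast
  ultimately show ?thesis using that L_eq_0_iff by blast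
qed

lemma sec_zero: "sec (L 0) = Q"
  by (simp add: sec_def L_zero)

lemma zero_not_circle: "Q \<notin> circles"
proof
  assume "Q \<in> circles"
  hence "q^2 + 1 = q + 1" using inv.circ_card cardQ by metis
  thus False using q_gt3 by (simp add: power2_eq_square)
qed

lemma two_in_circle:
  assumes "C \<in> circles"
  obtains P R where "P \<in> C" "R \<in> C" "P \<noteq> R"
proof -
  have "2 \<le> card C" using inv.circ_card[OF assms] q_gt3 by simp
  then obtain A where "A \<subseteq> C" "card A = 2" by (meson obtain_subset_with_card_n)
  thus ?thesis using that by (auto simp: card_2_iff)
qed

lemma pole_nonisotropic:
  assumes "sec (L c) \<in> circles"
  shows "B c c \<noteq> 0"
proof
  assume 0: "B c c = 0"
  have c: "c \<noteq> 0" using assms zero_not_circle sec_zero by auto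
  obtain P R where "P \<in> sec (L c)" "R \<in> sec (L c)" "P \<noteq> R" using two_in_circle[OF assms] .
  thus False using isotropic_no_secant[OF c 0, of P R] by (simp add: in_sec_L)
qed

text \<open>A plane meeting \<open>Q\<close> in \<open>R\<close> alone is the tangent plane, whose
  pole is an isotropic multiple of \<open>v R\<close>; any other plane through \<open>R\<close> has
  a second point.\<close>

lemma nonisotropic_circle:
  assumes c: "B c c \<noteq> 0" and R: "R \<in> sec (L c)"
  shows "sec (L c) \<in> circles"
proof -
  have c0: "L c \<noteq> 0" using c L_eq_0_iff by auto
  have RQ: "R \<in> Q" using R by (simp add: in_sec_L)
  have "sec (L c) \<noteq> {R}"
  proof
    assume "sec (L c) = {R}"
    then obtain t where "L c = t *s L (v R)"
      using tangent_plane(2)[OF RQ L_props(4)[OF RQ]] by blast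
    hence "L c = L (t *s v R)" by (simp add: L_props(2))
    hence "c = t *s v R" by (rule L_inj)
    thus False using c RQ by simp
  qed
  then obtain S where "S \<in> sec (L c)" "R \<noteq> S" using R by blast
  thus ?thesis using circlesI[OF c0] sec_card[OF c0 R] by blast
qed

lemma pole_unique:
  assumes C: "sec (L c) \<in> circles" and D: "sec (L d) = sec (L c)"
  obtains t where "t \<noteq> 0" "d = t *s c"
proof -
  have c: "c \<noteq> 0" and d: "d \<noteq> 0" using assms zero_not_circle sec_zero by auto
  have "3 \<le> card (sec (L c))" using inv.circ_card[OF C] q_gt3 by simp
  then obtain A where A: "A \<subseteq> sec (L c)" "card A = 3" by (meson obtain_subset_with_card_n)
  then obtain P R T where A3: "A = {P,R,T}" "P \<noteq> R" "R \<noteq> T" "P \<noteq> T" by (auto simp: card_3_iff)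
  have S: "P \<in> sec (L c)" "R \<in> sec (L c)" "T \<in> sec (L c)" using A A3 by auto
  have S': "P \<in> sec (L d)" "R \<in> sec (L d)" "T \<in> sec (L d)" using S D by auto
  have "indep3 (v P) (v R) (v T)" using S A3 by (intro indep) (auto simp: in_sec)
  then obtain t where "L d = t *s L c"
    using annihilator_proportional[of "v P" "v R" "v T" "L c" "L d"] S S' c L_eq_0_iff
    by (auto simp: in_sec)
  hence "L d = L (t *s c)" by (simp add: L_props(2))
  hence "d = t *s c" by (rule L_inj)
  moreover from this have "t \<noteq> 0" using d by auto
  ultimately show ?thesis using that by blast
qed

text \<open>The circles tangent to \<open>sec (L c)\<close> at \<open>R\<close> have their poles on the line joining \<open>c\<close> and
  \<open>v R\<close>, on which the quadratic form is constant.\<close>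

lemma pencil_norm:
  assumes "R \<in> sec (L c)"
  shows "B (c + t *s v R) (c + t *s v R) = B c c"
  using assms B_commute[of "v R" c] by (simp add: in_sec_L)

lemma pencil_circle:
  assumes C: "sec (L c) \<in> circles" and R: "R \<in> sec (L c)"
  shows "sec (L (c + t *s v R)) \<in> circles" and "t \<noteq> 0 \<Longrightarrow> sec (L (c + t *s v R)) \<inter> sec (L c) = {R}"
proof -
  have RE: "R \<in> sec (L (c + t *s v R))" using R by (simp add: in_sec_L)
  have "B (c + t *s v R) (c + t *s v R) \<noteq> 0"
    unfolding pencil_norm[OF R] by (rule pole_nonisotropic[OF C])
  thus "sec (L (c + t *s v R)) \<in> circles" by (rule nonisotropic_circle[OF _ RE])
  show "sec (L (c + t *s v R)) \<inter> sec (L c) = {R}" if "t \<noteq> 0"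
  proof -
    have "S = R" if "S \<in> sec (L (c + t *s v R))" "S \<in> sec (L c)" for S
      using that \<open>t \<noteq> 0\<close> R B_points[of R S] by (simp add: in_sec_L)
    thus ?thesis using RE R by blast
  qed
qed

lemma tangent_pole:
  assumes C: "sec (L c) \<in> circles" and E: "E \<in> circles" "E \<inter> sec (L c) = {R}"
  obtains t where "E = sec (L (c + t *s v R))"
proof -
  have R: "R \<in> sec (L c)" "R \<in> E" using E(2) by blast+
  obtain P1 P2 where "P1 \<in> E" "P2 \<in> E" "P1 \<noteq> P2" using two_in_circle[OF E(1)] .
  then obtain P where P: "P \<in> E" "P \<noteq> R" by metis
  have PC: "P \<notin> sec (L c)" using P E(2) by blast
  have PQ: "P \<in> Q" "R \<in> Q" using P R E(1) inv.circ_sub by (auto simp: in_sec)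
  have BRP: "B (v R) (v P) \<noteq> 0" using B_points PQ P by auto
  have BcP: "B c (v P) \<noteq> 0" using PC PQ by (simp add: in_sec_L)
  \<comment> \<open>Makes \<open>c + t *s v R\<close> orthogonal to \<open>v P\<close>, so that its
    circle passes through \<open>P\<close> and touches at \<open>R\<close>; only one circle does
    so.\<close>
  define t where "t = - (B c (v P) / B (v R) (v P))"
  have t0: "t \<noteq> 0" using BRP BcP by (simp add: t_def)
  have "P \<in> sec (L (c + t *s v R))" using PQ BRP by (simp add: in_sec_L t_def)
  hence "E = sec (L (c + t *s v R))"
    using inv.touch_unique[OF C R(1) PQ(1) PC pencil_circle(1)[OF C R(1)] _ pencil_circle(2)[OF C R(1) t0] E(1) P(1) E(2)]
    by blast
  thus ?thesis using that by blast
qed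

text \<open>The norms of all poles are collected, so that no pole has to be chosen: for a circle
  they form a coset of the nonzero squares.\<close>

definition cls :: "'p set \<Rightarrow> 'a set" where
  "cls C = {B c c | c. sec (L c) = C}"

lemma cls_eq:
  assumes C: "sec (L c) \<in> circles"
  shows "cls (sec (L c)) = {t^2 * B c c | t. t \<noteq> 0}"
proof -
  have "n \<in> cls (sec (L c)) \<longleftrightarrow> n \<in> {t^2 * B c c | t. t \<noteq> 0}" for n
  proof
    assume "n \<in> cls (sec (L c))"
    then obtain d where d: "n = B d d" "sec (L d) = sec (L c)" by (auto simp: cls_def)
    then obtain t where t: "t \<noteq> 0" "d = t *s c" using pole_unique[OF C] by blast
    hence "n = t^2 * B c c" using d by (simp add: power2_eq_square)
    thus "n \<in> {t^2 * B c c | t. t \<noteq> 0}" using t by blast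
  next
    assume "n \<in> {t^2 * B c c | t. t \<noteq> 0}"
    then obtain t where t: "t \<noteq> 0" "n = t^2 * B c c" by blast
    have "sec (L (t *s c)) = sec (L c)" using t sec_scale by (simp add: L_props(2))
    moreover have "n = B (t *s c) (t *s c)" using t by (simp add: power2_eq_square)
    ultimately show "n \<in> cls (sec (L c))" unfolding cls_def by blast
  qed
  thus ?thesis by blast
qed

lemma cls_tangent:
  assumes C: "C \<in> circles" and E: "E \<in> circles" "card (E \<inter> C) = 1"
  shows "cls E = cls C"
proof -
  obtain c where c: "C = sec (L c)" using circle_pole[OF C] .
  obtain R where R: "E \<inter> C = {R}" using E(2) by (rule card_1_singletonE)
  have RC: "R \<in> sec (L c)" using R c by blast
  have C': "sec (L c) \<in> circles" using C c by simp
  obtain t where t: "E = sec (L (c + t *s v R))"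
    using tangent_pole[OF C' E(1)] R c by metis
  show ?thesis
    unfolding t c cls_eq[OF C'] cls_eq[OF pencil_circle(1)[OF C' RC]] pencil_norm[OF RC] ..
qed

text \<open>The three values make \<open>e - d\<close> isotropic, hence a multiple of a point of
  \<open>Q\<close>, and this point is orthogonal to both poles. A common point of the circles is
  orthogonal to it and therefore equal to it.\<close>

lemma tangent_if_norms:
  assumes e: "B e e = n" and d: "B d d = n" and ed: "B e d = n" and ne: "sec (L e) \<noteq> sec (L d)"
  shows "card (sec (L e) \<inter> sec (L d)) = 1"
proof -
  have "e - d \<noteq> 0" using ne by auto
  moreover have "B (e - d) (e - d) = 0" using e d ed B_commute[of d e] by simp
  ultimately obtain S s where S: "S \<in> Q" "s \<noteq> 0" "e - d = s *s v S" using isotropic_point by blast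
  have "B (s *s v S) e = 0" "B (s *s v S) d = 0"
    unfolding S(3)[symmetric] using e d ed B_commute[of d e] by simp_all
  hence "B (v S) e = 0" "B (v S) d = 0" using S(2) by simp_all
  hence SS: "S \<in> sec (L e) \<inter> sec (L d)" using S(1) B_commute by (simp add: in_sec_L)
  have "S' = S" if S': "S' \<in> sec (L e) \<inter> sec (L d)" for S'
  proof -
    have "B (e - d) (v S') = 0" using S' by (simp add: in_sec_L)
    hence "B (v S) (v S') = 0" unfolding S(3) using S(2) by simp
    thus ?thesis using B_points S(1) S' by (simp add: in_sec_L)
  qed
  hence "sec (L e) \<inter> sec (L d) = {S}" using SS by blast
  thus ?thesis by simp
qed

text \<open>The pole \<open>d\<close> is a multiple m of a vector on the pencil line through
  \<open>e\<close>, where the norm is constant; equal norms leave m = 1 or m = -1, whence the two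
  signs.\<close>

lemma norms_if_tangent:
  assumes e: "B e e = n" and d: "B d d = n"
    and E: "sec (L e) \<in> circles" and D: "sec (L d) \<in> circles"
    and 1: "card (sec (L e) \<inter> sec (L d)) = 1"
  shows "B e d = n \<or> B e d = - n"
proof -
  have n0: "n \<noteq> 0" using pole_nonisotropic[OF E] e by simp
  obtain S where S: "sec (L d) \<inter> sec (L e) = {S}"
    using 1 by (metis Int_commute card_1_singletonE)
  have SE: "S \<in> sec (L e)" using S by blast
  obtain s where s: "sec (L d) = sec (L (e + s *s v S))" using tangent_pole[OF E D S] .
  have "sec (L (e + s *s v S)) \<in> circles" using s D by simp
  then obtain m where m: "m \<noteq> 0" "d = m *s (e + s *s v S)" using pole_unique s by blast
  have "B d d = m * m * B (e + s *s v S) (e + s *s v S)"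
    unfolding m(2) B_simps(3,4) by (simp only: mult.assoc)
  hence "n = m * m * n" unfolding pencil_norm[OF SE] d e .
  hence "m * m = 1" using n0 by simp
  hence "m = 1 \<or> m = -1" by (simp add: square_eq_1_iff)
  moreover have "B e d = m * n" unfolding m(2) using SE e by (simp add: in_sec_L)
  ultimately show ?thesis by auto
qed

text \<open>Equal classes allow poles \<open>c\<close> and \<open>d\<close> of the same norm
  \<open>n\<close>. Along the pencil \<open>c + t *s v R\<close>, tangency to \<open>D\<close> says
  that the inner product with \<open>d\<close> is \<open>n\<close> or \<open>-n\<close>. These are
  two linear equations in t, solvable because \<open>R\<close> is off \<open>D\<close>, with
  different solutions because \<open>2 * n\<close> is nonzero.\<close>

lemma pencil_two:
  assumes CD: "C \<in> circles" "D \<in> circles" "cls C = cls D" and R: "R \<in> C" "R \<notin> D"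
  shows "card {E \<in> circles. (E = C \<or> E \<inter> C = {R}) \<and> card (E \<inter> D) = 1} = 2"
proof -
  obtain c where c: "C = sec (L c)" using circle_pole[OF CD(1)] .
  define n where "n = B c c"
  have C: "sec (L c) \<in> circles" using CD c by simp
  have n0: "n \<noteq> 0" unfolding n_def by (rule pole_nonisotropic[OF C])
  have "n \<in> cls C" unfolding cls_def n_def c by blast
  \<comment> \<open>This provides a pole of \<open>D\<close> whose norm is \<open>n\<close> itself,
    not merely a square multiple of it.\<close>
  hence "n \<in> cls D" using CD by simp
  then obtain d where d: "sec (L d) = D" "B d d = n" by (auto simp: cls_def)
  have D: "sec (L d) \<in> circles" using CD d by simp
  have Rc: "R \<in> sec (L c)" using R c by simp
  have RQ: "R \<in> Q" using Rc by (simp add: in_sec)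
  have "B d (v R) \<noteq> 0" using R(2) RQ unfolding d(1)[symmetric] by (simp add: in_sec_L)
  hence BRd: "B (v R) d \<noteq> 0" using B_commute[of "v R" d] by simp
  define f where "f t = sec (L (c + t *s v R))" for t
  have f_circ: "f t \<in> circles" for t unfolding f_def by (rule pencil_circle(1)[OF C Rc])
  have Rf: "R \<in> f t" for t using Rc by (simp add: f_def in_sec_L)
  have f_tang: "card (f t \<inter> D) = 1 \<longleftrightarrow> B c d + t * B (v R) d = n \<or> B c d + t * B (v R) d = - n" for t
  proof -
    have e: "B (c + t *s v R) (c + t *s v R) = n" unfolding n_def by (rule pencil_norm[OF Rc])
    have ne: "f t \<noteq> D" using Rf R by blast
    have "card (f t \<inter> D) = 1" if "B (c + t *s v R) d = n"
      using tangent_if_norms[OF e d(2) that] ne by (simp add: f_def d(1))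
    moreover have "card (f t \<inter> D) = 1" if "B (c + t *s v R) d = - n"
    proof -
      have m: "sec (L (- d)) = D" using d(1) by (simp add: L_minus sec_def)
      have "B (- d) (- d) = n" "B (c + t *s v R) (- d) = n" using d(2) that by simp_all
      from tangent_if_norms[OF e this] show ?thesis using ne by (simp add: f_def m)
    qed
    moreover have "B (c + t *s v R) d = n \<or> B (c + t *s v R) d = - n" if "card (f t \<inter> D) = 1"
      using norms_if_tangent[OF e d(2) _ D] that f_circ by (simp add: f_def d(1))
    ultimately show ?thesis by auto
  qed
  define t1 t2 where "t1 = (n - B c d) / B (v R) d" and "t2 = (- n - B c d) / B (v R) d"
  have "B c d + t * B (v R) d = n \<longleftrightarrow> t = t1" "B c d + t * B (v R) d = - n \<longleftrightarrow> t = t2" for t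
    using BRd by (auto simp: t1_def t2_def field_simps)
  hence tang: "card (f t \<inter> D) = 1 \<longleftrightarrow> t \<in> {t1, t2}" for t using f_tang by simp
  have "t1 \<noteq> t2"
  proof
    assume "t1 = t2"
    hence "n - B c d = - n - B c d" using BRd by (simp add: t1_def t2_def)
    hence "2 * n = 0" by (simp add: algebra_simps)
    thus False using n0 two_nz by simp
  qed
  have inj: "inj f"
  proof (rule injI)
    fix s t assume "f s = f t"
    hence "sec (L (c + s *s v R)) = sec (L (c + t *s v R))" by (simp add: f_def)
    then obtain m where m: "c + s *s v R = m *s (c + t *s v R)"
      using pole_unique[OF f_circ[of t, unfolded f_def]] by metis
    \<comment> \<open>Pairing with \<open>c\<close> removes the multiples of \<open>v R\<close> and
      leaves m = 1.\<close>
    have "B (c + s *s v R) c = m * B (c + t *s v R) c" unfolding m by simp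
    hence "n = m * n" using Rc B_commute[of "v R" c] by (simp add: n_def in_sec_L)
    hence "m = 1" using n0 by simp
    hence "(s - t) *s v R = 0" using m by simp
    thus "s = t" using pt_nonzero[OF RQ] by simp
  qed
  have "{E \<in> circles. (E = C \<or> E \<inter> C = {R}) \<and> card (E \<inter> D) = 1} = f ` {t1, t2}"
  proof (intro equalityI subsetI)
    fix E assume "E \<in> {E \<in> circles. (E = C \<or> E \<inter> C = {R}) \<and> card (E \<inter> D) = 1}"
    hence E: "E \<in> circles" "E = C \<or> E \<inter> C = {R}" "card (E \<inter> D) = 1" by auto
    have "\<exists>t. E = f t"
      using E(2)
    proof
      assume "E = C"
      hence "E = f 0" by (simp add: f_def c)
      thus ?thesis ..
    next
      assume "E \<inter> C = {R}"
      then obtain t where "E = sec (L (c + t *s v R))" using tangent_pole[OF C E(1)] c by metis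
      hence "E = f t" by (simp add: f_def)
      thus ?thesis ..
    qed
    thus "E \<in> f ` {t1, t2}" using tang E(3) by auto
  next
    fix E assume "E \<in> f ` {t1, t2}"
    then obtain t where t: "E = f t" "t \<in> {t1, t2}" by blast
    have "f t = C \<or> f t \<inter> C = {R}"
      using pencil_circle(2)[OF C Rc, of t] by (cases "t = 0") (auto simp: f_def c)
    thus "E \<in> {E \<in> circles. (E = C \<or> E \<inter> C = {R}) \<and> card (E \<inter> D) = 1}"
      using t f_circ tang by simp
  qed
  thus ?thesis using \<open>t1 \<noteq> t2\<close> inj by (simp add: inj_eq card_insert_if)
qed

sublocale moebius: moebius_plane Q circles q cls
  by unfold_locales (use odd_q cls_tangent pencil_two in auto)

end

section \<open>Ovoids of PG(3,q)\<close>

definition rep :: "('a::{field,finite} ^ 4) set \<Rightarrow> 'a ^ 4" where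
  "rep P = (SOME x. x \<in> P \<and> x \<noteq> 0)"

lemma pg_point:
  assumes "P \<in> pg_points"
  shows "rep P \<noteq> 0" and "P = range (\<lambda>t. t *s rep P)"
proof -
  have P: "vec.subspace P" "vec.dim P = 1" using assms by (auto simp: pg_points_def)
  obtain B where B: "B \<subseteq> P" "vec.independent B" "P \<subseteq> vec.span B" "card B = vec.dim P"
    using vec.basis_exists by blast
  obtain b where b: "B = {b}" using B(4) P(2) by (auto simp: card_1_singleton_iff)
  have b0: "b \<noteq> 0" using B(2) b by (metis singletonI vec.dependent_zero)
  have Pb: "P = range (\<lambda>t. t *s b)"
  proof
    show "P \<subseteq> range (\<lambda>t. t *s b)" using B(3) b vec.span_singleton by blast
    show "range (\<lambda>t. t *s b) \<subseteq> P" using B(1) b P(1) vec.subspace_scale by blast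
  qed
  have "\<exists>x. x \<in> P \<and> x \<noteq> 0" using B(1) b b0 by blast
  hence r: "rep P \<in> P \<and> rep P \<noteq> 0" unfolding rep_def by (rule someI_ex)
  thus "rep P \<noteq> 0" by simp
  obtain s where s: "rep P = s *s b" using r Pb by blast
  have s0: "s \<noteq> 0" using r s by auto
  show "P = range (\<lambda>t. t *s rep P)"
  proof
    show "P \<subseteq> range (\<lambda>t. t *s rep P)"
    proof
      fix x assume "x \<in> P"
      then obtain t where "x = t *s b" using Pb by blast
      hence "x = (t / s) *s rep P" using s s0 by (simp add: vec.scale_scale)
      thus "x \<in> range (\<lambda>t. t *s rep P)" by blast
    qed
    show "range (\<lambda>t. t *s rep P) \<subseteq> P" using r P(1) vec.subspace_scale by blast
  qed
qed

lemma pg_point_subset_iff: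
  assumes "P \<in> pg_points" "vec.subspace V"
  shows "P \<subseteq> V \<longleftrightarrow> rep P \<in> V"
proof
  assume "P \<subseteq> V"
  moreover have "1 *s rep P \<in> P" by (subst pg_point(2)[OF assms(1)]) (rule rangeI)
  ultimately show "rep P \<in> V" by auto
next
  assume "rep P \<in> V"
  hence "range (\<lambda>t. t *s rep P) \<subseteq> V" using assms(2) vec.subspace_scale by blast
  thus "P \<subseteq> V" using pg_point(2)[OF assms(1)] by simp
qed

lemma pg_point_eqI:
  assumes "P \<in> pg_points" "R \<in> pg_points" "rep P = t *s rep R"
  shows "P = R"
proof -
  have t: "t \<noteq> 0" using pg_point(1)[OF assms(1)] assms(3) by auto
  have "range (\<lambda>s. s *s rep P) = range (\<lambda>s. s *s rep R)"
  proof
    show "range (\<lambda>s. s *s rep P) \<subseteq> range (\<lambda>s. s *s rep R)"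
      unfolding assms(3) by (auto simp: vec.scale_scale)
    show "range (\<lambda>s. s *s rep R) \<subseteq> range (\<lambda>s. s *s rep P)"
    proof
      fix x assume "x \<in> range (\<lambda>s. s *s rep R)"
      then obtain s where "x = s *s rep R" by blast
      hence "x = (s / t) *s rep P" using t by (simp add: assms(3) vec.scale_scale)
      thus "x \<in> range (\<lambda>s. s *s rep P)" by blast
    qed
  qed
  thus ?thesis using pg_point(2)[OF assms(1)] pg_point(2)[OF assms(2)] by simp
qed

lemma eq_scaleI:
  fixes x y :: "'a::field ^ 'n"
  assumes "a *s x + b *s y = 0" "a \<noteq> 0"
  shows "x = (- (b / a)) *s y"
proof -
  have "(1 / a) *s (a *s x + b *s y) = 0" using assms(1) by simp
  hence "x + (b / a) *s y = 0" using assms(2) by (simp add: vec.scale_right_distrib vec.scale_scale)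
  thus ?thesis by (simp add: eq_neg_iff_add_eq_0)
qed

lemma distinct_points_independent:
  assumes "P \<in> pg_points" "R \<in> pg_points" "P \<noteq> R" "a *s rep P + b *s rep R = 0"
  shows "a = 0 \<and> b = 0"
proof -
  have "a = 0" using eq_scaleI[OF assms(4)] pg_point_eqI[OF assms(1,2)] assms(3) by blast
  thus ?thesis using assms(4) pg_point(1)[OF assms(2)] by simp
qed

lemma span2: "vec.span {x, y} = {a *s x + b *s y | a b. True}"
proof (intro equalityI subsetI)
  fix z assume "z \<in> vec.span {x, y}"
  then obtain k where "z - k *s x \<in> vec.span {y}" by (auto simp: vec.span_insert)
  then obtain t where "z - k *s x = t *s y" unfolding vec.span_singleton by blast
  hence "z = k *s x + t *s y" by (simp add: algebra_simps)
  thus "z \<in> {a *s x + b *s y | a b. True}" by blast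
next
  fix z assume "z \<in> {a *s x + b *s y | a b. True}"
  then obtain a b where "z = a *s x + b *s y" by blast
  thus "z \<in> vec.span {x, y}" by (simp add: vec.span_add vec.span_scale vec.span_base)
qed

text \<open>Two different points span a projective line, and a relation with a nonzero coefficient
  at the third vector would put the third point on it.\<close>

lemma no_three_indep3:
  assumes S: "no_three_on_a_line S" "S \<subseteq> pg_points"
    and P: "P \<in> S" "R \<in> S" "T \<in> S" "P \<noteq> R" "P \<noteq> T" "R \<noteq> T"
  shows "indep3 (rep P) (rep R) (rep T)"
  unfolding indep3_def
proof (intro allI impI)
  fix a b c assume e: "a *s rep P + b *s rep R + c *s rep T = 0"
  have pts: "P \<in> pg_points" "R \<in> pg_points" "T \<in> pg_points" using S P by auto
  let ?L = "vec.span {rep P, rep R}"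
  have ne: "rep P \<noteq> t *s rep R" for t using pg_point_eqI[OF pts(1,2)] P by blast
  have "rep P \<notin> vec.span {rep R}" using ne unfolding vec.span_singleton by blast
  moreover have "vec.independent {rep R}"
    using pg_point(1)[OF pts(2)] by (simp add: vec.independent_insert)
  ultimately have "vec.independent {rep P, rep R}" by (simp add: vec.independent_insert)
  hence "vec.dim ?L = card {rep P, rep R}" by (rule vec.dim_span_eq_card_independent)
  also have "\<dots> = 2" using ne[of 1] by simp
  finally have L: "?L \<in> pg_lines" by (simp add: pg_lines_def)
  have subL: "rep P \<in> ?L" "rep R \<in> ?L" by (simp_all add: vec.span_base)
  have "c = 0"
  proof (rule ccontr)
    assume c: "c \<noteq> 0"
    have "c *s rep T + 1 *s (a *s rep P + b *s rep R) = 0" using e by (simp add: add_ac)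
    from eq_scaleI[OF this c] have "rep T = (- (1 / c)) *s (a *s rep P + b *s rep R)" .
    moreover have "a *s rep P + b *s rep R \<in> ?L" unfolding span2 by blast
    ultimately have "rep T \<in> ?L" by (metis vec.span_scale)
    hence "P \<subseteq> ?L \<and> R \<subseteq> ?L \<and> T \<subseteq> ?L"
      using subL pts pg_point_subset_iff[OF _ vec.subspace_span] by blast
    thus False using S(1) P L unfolding no_three_on_a_line_def by blast
  qed
  thus "a = 0 \<and> b = 0 \<and> c = 0" using e distinct_points_independent[OF pts(1,2) P(4)] by simp
qed

lemma no_three_on_a_line_subset:
  assumes "no_three_on_a_line S" "T \<subseteq> S"
  shows "no_three_on_a_line T"
  unfolding no_three_on_a_line_def
proof (intro ballI impI)
  fix P R U assume "P \<in> T" "R \<in> T" "U \<in> T" "P \<noteq> R \<and> P \<noteq> U \<and> R \<noteq> U"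
  moreover from this have "P \<in> S" "R \<in> S" "U \<in> S" using assms(2) by auto
  ultimately show "\<not> (\<exists>L\<in>pg_lines. P \<subseteq> L \<and> R \<subseteq> L \<and> U \<subseteq> L)"
    using assms(1)[unfolded no_three_on_a_line_def, rule_format, of P R U] by simp
qed

lemma hyperplane_span:
  assumes "indep3 x y z" "u \<noteq> 0" "dot u x = 0" "dot u y = 0" "dot u z = 0"
  shows "vec.span {x, y, z} = {w. dot u w = 0}" and "vec.dim {w. dot u w = 0} = 3"
proof -
  have sub: "vec.subspace {w. dot u w = 0}" by (auto simp: vec.subspace_def)
  show sp: "vec.span {x, y, z} = {w. dot u w = 0}"
  proof
    show "vec.span {x, y, z} \<subseteq> {w. dot u w = 0}"
      using assms(3-5) by (intro vec.span_minimal sub) auto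
    show "{w. dot u w = 0} \<subseteq> vec.span {x, y, z}"
    proof
      fix w assume "w \<in> {w. dot u w = 0}"
      then obtain a b c where "w = a *s x + b *s y + c *s z"
        using hyperplane_span3[OF assms] by blast
      thus "w \<in> vec.span {x, y, z}" by (simp add: vec.span_add vec.span_scale vec.span_base)
    qed
  qed
  have d: "y \<noteq> t *s z" "z \<noteq> 0" "x \<noteq> a *s y + b *s z" for t a b
    using indep3D[OF assms(1), of 0 1 "-t"] indep3D[OF assms(1), of 0 0 1]
      indep3D[OF assms(1), of 1 "-a" "-b"] by auto
  have "y \<notin> vec.span {z}" using d(1) unfolding vec.span_singleton by blast
  moreover have "vec.independent {z}" using d(2) by (simp add: vec.independent_insert)
  ultimately have "vec.independent {y, z}" by (simp add: vec.independent_insert)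
  moreover have "x \<notin> vec.span {y, z}" using d(3) unfolding span2 by blast
  ultimately have "vec.independent {x, y, z}" using d(2) by (simp add: vec.independent_insert)
  hence "vec.dim (vec.span {x, y, z}) = card {x, y, z}" by (rule vec.dim_span_eq_card_independent)
  also have "\<dots> = 3" using d(1)[of 1] d(3)[of 1 0] d(3)[of 0 1] by simp
  finally show "vec.dim {w. dot u w = 0} = 3" unfolding sp .
qed

lemma card_ge_3:
  assumes "3 \<le> card S"
  obtains P R T where "P \<in> S" "R \<in> S" "T \<in> S" "P \<noteq> R" "P \<noteq> T" "R \<noteq> T"
proof -
  obtain A where A: "A \<subseteq> S" "card A = 3" using assms by (meson obtain_subset_with_card_n)
  then obtain P R T where "A = {P,R,T}" "P \<noteq> R" "R \<noteq> T" "P \<noteq> T" by (auto simp: card_3_iff)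
  thus ?thesis using that[of P R T] A by auto
qed

lemma ovoid_ovoid_vec:
  fixes Q :: "('a::{field,finite} ^ 4) set set"
  assumes "q = CARD('a)" "odd q" "q > 3" "ovoid Q"
  shows "ovoid_vec Q rep q"
proof
  have Q: "Q \<subseteq> pg_points" "card Q = CARD('a)^2 + 1" "no_three_on_a_line Q"
    using assms(4) by (auto simp: ovoid_def)
  show "finite Q" using Q(2) by (metis add_is_0 card.infinite one_neq_zero)
  show "card Q = q^2 + 1" using Q(2) assms(1) by simp
  show "indep3 (rep P) (rep R) (rep S)"
    if "P \<in> Q" "R \<in> Q" "S \<in> Q" "P \<noteq> R" "P \<noteq> S" "R \<noteq> S" for P R S
    by (rule no_three_indep3[OF Q(3,1) that])
qed (use assms in auto)

text \<open>A plane is a subspace of dimension 3 on one side and the kernel of a nonzero form on the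
  other. Three points of a circle span it in both descriptions, and equal dimensions identify the
  two.\<close>

lemma moebius_circles_eq:
  fixes Q :: "('a::{field,finite} ^ 4) set set"
  assumes q: "q = CARD('a)" "odd q" "q > 3" and ov: "ovoid Q"
  shows "moebius_circles Q = ovoid_vec.circles Q rep q"
proof -
  interpret ovoid_vec Q rep q by (rule ovoid_ovoid_vec[OF assms])
  have Q: "Q \<subseteq> pg_points" "no_three_on_a_line Q" using ov by (auto simp: ovoid_def)
  have plane: "plane_section \<pi> Q = sec u" if "\<pi> = {w. dot u w = 0}" for \<pi> u
  proof -
    have s: "vec.subspace {w. dot u w = 0}" by (auto simp: vec.subspace_def)
    have "P \<subseteq> \<pi> \<longleftrightarrow> dot u (rep P) = 0" if "P \<in> Q" for P
      using pg_point_subset_iff[OF subsetD[OF Q(1) that] s] unfolding \<open>\<pi> = _\<close> by simp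
    thus ?thesis unfolding plane_section_def sec_def by blast
  qed
  show ?thesis
  proof (intro equalityI subsetI)
    fix C assume "C \<in> moebius_circles Q"
    then obtain \<pi> where \<pi>: "C = plane_section \<pi> Q" "\<pi> \<in> pg_planes" "oval_in \<pi> C"
      by (auto simp: moebius_circles_def oval_plane_def)
    have cC: "card C = q + 1" using \<pi>(3) by (simp add: oval_in_def)
    hence "3 \<le> card C" using q(3) by simp
    then obtain P R T where PRT: "P \<in> C" "R \<in> C" "T \<in> C" and ne: "P \<noteq> R" "P \<noteq> T" "R \<noteq> T"
      by (rule card_ge_3)
    have PQ: "P \<in> Q" "R \<in> Q" "T \<in> Q" and P\<pi>: "P \<subseteq> \<pi>" "R \<subseteq> \<pi>" "T \<subseteq> \<pi>"
      using PRT \<pi>(1) by (auto simp: plane_section_def)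
    have s\<pi>: "vec.subspace \<pi>" "vec.dim \<pi> = 3" using \<pi>(2) by (auto simp: pg_planes_def)
    have ind: "indep3 (rep P) (rep R) (rep T)" by (rule indep[OF PQ ne])
    obtain u where u: "u \<noteq> 0" "dot u (rep P) = 0" "dot u (rep R) = 0" "dot u (rep T) = 0"
      using annihilator_exists[OF ind] by blast
    have "{w. dot u w = 0} = vec.span {rep P, rep R, rep T}"
      using hyperplane_span(1)[OF ind u] by simp
    also have "\<dots> \<subseteq> \<pi>"
      using P\<pi> PQ Q pg_point_subset_iff[OF _ s\<pi>(1)] by (intro vec.span_minimal s\<pi>(1)) blast
    finally have "{w. dot u w = 0} = \<pi>"
      using hyperplane_span(2)[OF ind u] s\<pi>
      by (intro vec.subspace_dim_equal) (auto simp: vec.subspace_def)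
    hence "C = sec u" using plane[of \<pi> u] \<pi>(1) by simp
    thus "C \<in> circles" using circlesI[OF u(1)] cC by simp
  next
    fix C assume C: "C \<in> circles"
    then obtain u where u: "u \<noteq> 0" "C = sec u" "card C = q + 1" by (auto simp: circles_def)
    hence "3 \<le> card C" using q(3) by simp
    then obtain P R T where PRT: "P \<in> C" "R \<in> C" "T \<in> C" and ne: "P \<noteq> R" "P \<noteq> T" "R \<noteq> T"
      by (rule card_ge_3)
    have PQ: "P \<in> Q" "R \<in> Q" "T \<in> Q" and du: "dot u (rep P) = 0" "dot u (rep R) = 0" "dot u (rep T) = 0"
      using PRT u(2) by (auto simp: in_sec)
    let ?\<pi> = "{w. dot u w = 0}"
    have s: "vec.subspace ?\<pi>" by (auto simp: vec.subspace_def)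
    have "?\<pi> \<in> pg_planes"
      using s hyperplane_span(2)[OF indep[OF PQ ne] u(1) du] by (simp add: pg_planes_def)
    moreover have sec: "plane_section ?\<pi> Q = C" using plane[of ?\<pi> u] u(2) by simp
    moreover have "oval_in ?\<pi> C"
    proof -
      have "C \<subseteq> Q" using u(2) sec_sub by simp
      hence "no_three_on_a_line C" by (rule no_three_on_a_line_subset[OF Q(2)])
      moreover have "C \<subseteq> {P \<in> pg_points. P \<subseteq> ?\<pi>}"
        unfolding sec[symmetric] plane_section_def using Q(1) by blast
      ultimately show ?thesis unfolding oval_in_def q_eq using u(3) by blast
    qed
    ultimately have "oval_plane Q ?\<pi>" unfolding oval_plane_def by simp
    thus "C \<in> moebius_circles Q" unfolding moebius_circles_def using sec by blast
  qed
qed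

theorem theorem6p2:
  fixes Q :: "('a::{field,finite} ^ 4) set set"
    and F :: "('a ^ 4) set set set"
    and q :: nat
  assumes "q = CARD('a)" and "odd q" and "q > 3"
    and "ovoid Q"
    and "intersecting_family Q F"
  shows "card F \<le> q * (q + 1) \<and>
    (card F = q * (q + 1) \<longleftrightarrow> (\<exists>P\<in>Q. F = {C \<in> moebius_circles Q. P \<in> C}))"
proof -
  interpret ovoid_vec Q rep q by (rule ovoid_ovoid_vec[OF assms(1-4)])
  have mc: "moebius_circles Q = circles" by (rule moebius_circles_eq[OF assms(1-4)])
  have F: "F \<subseteq> circles" and int: "\<And>C D. C \<in> F \<Longrightarrow> D \<in> F \<Longrightarrow> C \<inter> D \<noteq> {}"
    using assms(5) by (auto simp: intersecting_family_def mc)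
  show ?thesis
  proof (intro conjI iffI)
    show "card F \<le> q * (q + 1)" by (rule moebius.intersecting_card_le[OF F int])
    show "\<exists>P\<in>Q. F = {C \<in> moebius_circles Q. P \<in> C}" if "card F = q * (q + 1)"
      unfolding mc by (rule moebius.intersecting_card_eq[OF F int that])
    show "card F = q * (q + 1)" if "\<exists>P\<in>Q. F = {C \<in> moebius_circles Q. P \<in> C}"
      using that inv.one_count by (auto simp: mc)
  qed
qed

end
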